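(* Let $g_1,g_2,g_3$ be complex-valued functions defined on a (possibly unbounded) domain $D\subset\mathbb{R}^d$, $d\ge1$, such that $g_1\in\mathcal{C}^1(D)$, $g_2\in\mathcal{C}^2(D)$ and $g_3\in\mathcal{C}^3(D)$. Suppose that (i) $\mathrm{Re}\,g_3$ attains its global minimum at a unique interior point $w_0$ of $D$, at which $\nabla g_3(w_0)=\mathbf{0}$, $\mathrm{Re}\,\mathrm{Hess}_{g_3}(w_0)$ is positive-definite, and $g_1(w_0)\neq0$; (ii) there exists a constant $c_1>0$ such that the function $g_1e^{-c_1g_3}$ is absolutely integrable; (iii) there exists a constant $c_2>0$ such that $\mathrm{Re}\,g_2\le c_2\,\mathrm{Re}\,g_3$. Then, as $x\to\infty$, $$\int_Dg_1(w)\,e^{xg_2(w)-x^2g_3(w)}\,\mathrm{d}w=\frac{(2\pi)^{d/2}g_1(w_0)}{x^d(\det\mathrm{Hess}_{g_3}(w_0))^{1/2}}\exp\bigg(xg_2(w_0)-x^2g_3(w_0)+\frac12(\nabla g_2)^{\intercal}(w_0)\,\mathrm{Hess}_{g_3}^{-1}(w_0)\,\nabla g_2(w_0)\bigg)(1+O(x^{-1})).$$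
   Context: $\nabla g$ and $\mathrm{Hess}_g$ denote the gradient (column vector) and Hessian matrix of $g$ with respect to the real variables $w\in\mathbb{R}^d$, and $^{\intercal}$ denotes transpose (without complex conjugation). Fractional powers of complex numbers are taken to be their principal values. Here $x$ is a real variable.
   Formalization: Added to (i): outside some compact subset of D, Re g_3 exceeds Re g_3(w_0) by a fixed positive amount. Also (det Hess)^{1/2} is the product of principal roots of the eigenvalues, not the principal root of det (these can differ in sign for d≥3). Both literal readings are false. *)

theory Defs
  imports
    "HOL-Analysis.Analysis"
    "HOL-Computational_Algebra.Fundamental_Theorem_Algebra"
    "HOL-Library.Landau_Symbols"
begin

definition partial_deriv :: "'n \<Rightarrow> (real^'n \<Rightarrow> complex) \<Rightarrow> real^'n \<Rightarrow> complex"
  where "partial_deriv i f w = frechet_derivative f (at w) (axis i 1)"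

text \<open>Intended for open \<open>D\<close>, where differentiability within \<open>D\<close> is differentiability and
  the condition says that all partial derivatives of order at most \<open>k\<close> exist and are
  continuous on \<open>D\<close>.\<close>

primrec Ck_on :: "nat \<Rightarrow> (real^'n \<Rightarrow> complex) \<Rightarrow> (real^'n) set \<Rightarrow> bool"
  where
    "Ck_on 0 f D \<longleftrightarrow> continuous_on D f"
  | "Ck_on (Suc k) f D \<longleftrightarrow> f differentiable_on D \<and> (\<forall>i. Ck_on k (partial_deriv i f) D)"

definition gradient :: "(real^'n \<Rightarrow> complex) \<Rightarrow> real^'n \<Rightarrow> complex^'n"
  where "gradient f w = (\<chi> i. partial_deriv i f w)"

definition Hessian :: "(real^'n \<Rightarrow> complex) \<Rightarrow> real^'n \<Rightarrow> complex^'n^'n"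
  where "Hessian f w = (\<chi> i j. partial_deriv i (partial_deriv j f) w)"

definition Re_matrix :: "complex^'n^'n \<Rightarrow> real^'n^'n"
  where "Re_matrix A = (\<chi> i j. Re (A $ i $ j))"

text \<open>No symmetry requirement; the Hessian of a twice continuously differentiable function
  is symmetric anyway.\<close>

definition pos_definite :: "real^'n^'n \<Rightarrow> bool"
  where "pos_definite A \<longleftrightarrow> (\<forall>v. v \<noteq> 0 \<longrightarrow> v \<bullet> (A *v v) > 0)"

text \<open>The bilinear product without complex conjugation (the library's \<open>\<bullet>\<close> on complex vectors
  is the real part of the Hermitian product).\<close>

definition bilin_dot :: "complex^'n \<Rightarrow> complex^'n \<Rightarrow> complex"
  where "bilin_dot u v = (\<Sum>i\<in>UNIV. u $ i * v $ i)"

definition char_polynomial :: "complex^'n^'n \<Rightarrow> complex poly"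
  where "char_polynomial A = det (\<chi> i j. (if i = j then [:0, 1:] else 0) - [:A $ i $ j:])"

text \<open>The square root of the determinant in Gaussian integrals: the principal square root is taken
  of each eigenvalue (counted with algebraic multiplicity). For symmetric \<open>A\<close> with positive
  definite real part all eigenvalues have positive real part, and the product is the branch of
  \<open>(det A)\<^sup>1\<^sup>/\<^sup>2\<close> that depends continuously on \<open>A\<close> and is positive for real \<open>A\<close>. The principal root
  \<open>csqrt (det A)\<close> agrees with it in dimensions 1 and 2 (lemma \<open>sqrt_det_eq_csqrt\<close>), but from
  dimension 3 on it may differ from it by a sign: for \<open>A = (1 + \<i> t) I\<close> in dimension 3 with
  \<open>t > \<surd>3\<close>, \<open>csqrt (det A)\<close> is minus the product of the three roots \<open>csqrt (1 + \<i> t)\<close>.\<close>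

definition sqrt_det :: "complex^'n^'n \<Rightarrow> complex"
  where "sqrt_det A = prod_mset (image_mset csqrt (proots (char_polynomial A)))"

lemma poly_det:
  fixes M :: "complex poly^'n^'n"
  shows "poly (det M) z = det (\<chi> i j. poly (M $ i $ j) z)"
  by (simp add: det_def poly_sum poly_prod of_int_poly)

lemma poly_char_polynomial:
  "poly (char_polynomial A) z = det (\<chi> i j. (if i = j then z else 0) - A $ i $ j)"
  unfolding char_polynomial_def poly_det
  by (rule arg_cong[where f = det]) (simp add: vec_eq_iff)

lemma char_polynomial_degree:
  fixes A :: "complex^'n^'n"
  shows "degree (char_polynomial A) = CARD('n)" and "lead_coeff (char_polynomial A) = 1"
proof -
  let ?M = "\<lambda>i j. (if i = j then [:0, 1:] else 0) - [:A $ i $ j:]"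
  let ?t = "\<lambda>p. of_int (sign p) * (\<Prod>i\<in>UNIV. ?M i (p i))"
  let ?P = "{p. p permutes (UNIV :: 'n set)}"
  have fin: "finite ?P" by (simp add: finite_permutations)
  have idP: "id \<in> ?P" by (simp add: permutes_id)
  have diag: "?t id = (\<Prod>i\<in>UNIV. [:- (A $ i $ i), 1:])"
    by simp
  have dd: "degree (?t id) = CARD('n)"
    unfolding diag by (subst degree_prod_sum_eq) auto
  have dl: "lead_coeff (?t id) = 1"
    unfolding diag by (simp only: lead_coeff_prod) simp
  have rest: "degree (?t p) < CARD('n)" if p: "p \<in> ?P - {id}" for p
  proof -
    from p obtain k where k: "k \<noteq> p k" by (metis Diff_iff eq_id_iff insertCI)
    have "degree (?t p) \<le> degree (of_int (sign p) :: complex poly) + degree (\<Prod>i\<in>UNIV. ?M i (p i))"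
      by (rule degree_mult_le)
    also have "degree (of_int (sign p) :: complex poly) = 0" by simp
    also have "0 + degree (\<Prod>i\<in>UNIV. ?M i (p i)) \<le> (\<Sum>i\<in>UNIV. degree (?M i (p i)))"
      by (simp add: degree_prod_sum_le[unfolded o_def])
    also have "\<dots> < (\<Sum>i\<in>(UNIV :: 'n set). 1)"
      by (rule sum_strict_mono_ex1) (use k in auto)
    finally show ?thesis by simp
  qed
  have eq: "char_polynomial A = ?t id + (\<Sum>p\<in>?P - {id}. ?t p)"
    unfolding char_polynomial_def det_def
    by (subst sum.remove[OF fin idP]) simp_all
  have dr: "degree (\<Sum>p\<in>?P - {id}. ?t p) < CARD('n)"
    by (rule degree_sum_less) (use rest in auto)
  show "degree (char_polynomial A) = CARD('n)"
    unfolding eq using dr dd by (subst degree_add_eq_left) auto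
  have "degree (\<Sum>p\<in>?P - {id}. ?t p) < degree (?t id)"
    using dr unfolding dd .
  from lead_coeff_add_le[OF this] show "lead_coeff (char_polynomial A) = 1"
    unfolding dl add.commute[of _ "?t id"] unfolding eq .
qed

lemma prod_mset_power2_csqrt: "(prod_mset (image_mset csqrt M))\<^sup>2 = prod_mset M"
  by (induction M) (auto simp: power_mult_distrib simp del: csqrt.simps)

lemma char_polynomial_factors:
  "char_polynomial A = (\<Prod>z\<in>#proots (char_polynomial A). [:- z, 1:])"
  using complex_poly_decompose_multiset[of "char_polynomial A"] char_polynomial_degree(2)[of A]
  by simp

lemma size_proots_char_polynomial:
  fixes A :: "complex^'n^'n"
  shows "size (proots (char_polynomial A)) = CARD('n)"
  by (simp add: size_proots_complex char_polynomial_degree(1))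

lemma sqrt_det_power2: "(sqrt_det A)\<^sup>2 = det A"
  for A :: "complex^'n^'n"
proof -
  have neg: "poly (\<Prod>z\<in>#M. [:- z, 1::complex:]) 0 = (-1) ^ size M * prod_mset M"
    for M :: "complex multiset"
    by (induction M) (auto simp: algebra_simps)
  have "det (- A) = (-1) ^ CARD('n) * det A"
    unfolding det_def by (simp add: prod_uminus sum_distrib_left mult_ac)
  moreover have "det (- A) = poly (char_polynomial A) 0"
    unfolding poly_char_polynomial by (rule arg_cong[where f = det]) (simp add: vec_eq_iff)
  moreover have "poly (char_polynomial A) 0
      = (-1) ^ CARD('n) * prod_mset (proots (char_polynomial A))"
    by (subst char_polynomial_factors) (simp add: neg size_proots_char_polynomial)
  ultimately show ?thesis
    by (simp add: sqrt_det_def prod_mset_power2_csqrt)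
qed

lemma Re_eigenvalue_pos:
  fixes A :: "complex^'n^'n"
  assumes sym: "transpose A = A" and pd: "pos_definite (Re_matrix A)"
    and z: "z \<in># proots (char_polynomial A)"
  shows "Re z > 0"
proof -
  have "char_polynomial A \<noteq> 0"
    using char_polynomial_degree(2)[of A] by auto
  then have "poly (char_polynomial A) z = 0"
    using z by simp
  moreover define B where "B = (\<chi> i j. (if i = j then z else 0) - A $ i $ j)"
  ultimately have "\<not> invertible B"
    by (simp add: poly_char_polynomial invertible_det_nz)
  then have "\<not> (\<forall>v. B *v v = 0 \<longrightarrow> v = 0)"
    unfolding invertible_left_inverse matrix_left_invertible_ker .
  then obtain v where v: "v \<noteq> 0" "(\<chi> i j. (if i = j then z else 0) - A $ i $ j) *v v = 0"
    unfolding B_def by blast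
  define a b where "a = (\<chi> i. Re (v $ i))" and "b = (\<chi> i. Im (v $ i))"
  have ev: "(\<Sum>j\<in>UNIV. A $ i $ j * v $ j) = z * v $ i" for i
  proof -
    have "0 = (\<Sum>j\<in>UNIV. ((if i = j then z else 0) - A $ i $ j) * v $ j)"
      using arg_cong[OF v(2), of "\<lambda>u. u $ i"] by (simp add: matrix_vector_mult_def)
    also have "\<dots> = (\<Sum>j\<in>UNIV. (if i = j then z * v $ j else 0) - A $ i $ j * v $ j)"
      by (rule sum.cong) (auto simp: algebra_simps)
    also have "\<dots> = z * v $ i - (\<Sum>j\<in>UNIV. A $ i $ j * v $ j)"
      by (simp add: sum_subtractf)
    finally show ?thesis by simp
  qed
  have symA: "A $ i $ j = A $ j $ i" for i j
    using sym by (metis transpose_def vec_lambda_beta)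
  let ?q = "\<lambda>i j. Im (A $ i $ j) * (a $ i * b $ j)"
  have swap: "(\<Sum>i\<in>UNIV. \<Sum>j\<in>UNIV. ?q i j) = (\<Sum>i\<in>UNIV. \<Sum>j\<in>UNIV. Im (A $ i $ j) * (b $ i * a $ j))"
    by (subst sum.swap) (simp add: symA mult_ac)
  have "(\<Sum>i\<in>UNIV. cnj (v $ i) * (\<Sum>j\<in>UNIV. A $ i $ j * v $ j))
      = z * of_real (\<Sum>i\<in>UNIV. (cmod (v $ i))\<^sup>2)"
    unfolding ev of_real_sum sum_distrib_left
    by (rule sum.cong) (simp_all only: complex_norm_square mult_ac)
  then have "Re z * (\<Sum>i\<in>UNIV. (cmod (v $ i))\<^sup>2)
      = Re (\<Sum>i\<in>UNIV. cnj (v $ i) * (\<Sum>j\<in>UNIV. A $ i $ j * v $ j))"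
    by simp
  also have "\<dots> = (\<Sum>i\<in>UNIV. \<Sum>j\<in>UNIV. Re (A $ i $ j) * (a $ i * a $ j)
      + Re (A $ i $ j) * (b $ i * b $ j) - ?q i j + Im (A $ i $ j) * (b $ i * a $ j))"
    by (simp only: Re_sum sum_distrib_left)
       (intro sum.cong refl, simp add: a_def b_def algebra_simps)
  also have "\<dots> = a \<bullet> (Re_matrix A *v a) + b \<bullet> (Re_matrix A *v b)"
    by (simp add: sum.distrib sum_subtractf swap)
       (simp add: inner_vec_def matrix_vector_mult_def Re_matrix_def sum_distrib_left mult_ac)
  also have "\<dots> > 0"
  proof -
    have nn: "u \<bullet> (Re_matrix A *v u) \<ge> 0" for u
      using pd by (cases "u = 0") (auto simp: pos_definite_def intro: less_imp_le)
    have "a \<noteq> 0 \<or> b \<noteq> 0"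
      using v(1) by (auto simp: a_def b_def vec_eq_iff complex_eq_iff)
    then show ?thesis
      using pd nn[of a] nn[of b] unfolding pos_definite_def
      by (meson add_nonneg_pos add_pos_nonneg)
  qed
  finally have "0 < Re z * (\<Sum>i\<in>UNIV. (cmod (v $ i))\<^sup>2)" .
  moreover have "0 \<le> (\<Sum>i\<in>UNIV. (cmod (v $ i))\<^sup>2)"
    by (simp add: sum_nonneg)
  ultimately show ?thesis
    by (auto simp: zero_less_mult_iff)
qed

lemma sqrt_det_eq_csqrt:
  fixes A :: "complex^'n^'n"
  assumes sym: "transpose A = A" and pd: "pos_definite (Re_matrix A)" and card: "CARD('n) \<le> 2"
  shows "sqrt_det A = csqrt (det A)"
proof -
  let ?M = "proots (char_polynomial A)"
  have pos: "Re z > 0" if "z \<in># ?M" for z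
    using Re_eigenvalue_pos[OF sym pd that] .
  have "CARD('n) = 1 \<or> CARD('n) = 2"
    using card zero_less_card_finite[where 'a = 'n] by linarith
  then have "Re (sqrt_det A) > 0"
  proof
    assume "CARD('n) = 1"
    then obtain z where "?M = {#z#}"
      using size_proots_char_polynomial[of A] by (metis size_1_singleton_mset)
    then show ?thesis
      using pos[of z] by (auto simp: sqrt_det_def intro: add_nonneg_pos)
  next
    assume "CARD('n) = 2"
    then obtain y z where M: "?M = {#y, z#}"
      using size_proots_char_polynomial[of A] 
      by (metis One_nat_def Suc_1 size_1_singleton_mset size_eq_Suc_imp_eq_union size_add_mset
          nat.inject)
    have *: "\<bar>Im (csqrt u)\<bar> < Re (csqrt u)" if "Re u > 0" for u
      using that abs_Re_le_cmod[of u] by (auto simp: abs_mult sgn_if)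
    have "\<bar>Im (csqrt y) * Im (csqrt z)\<bar> < Re (csqrt y) * Re (csqrt z)"
      unfolding abs_mult using *[of y] *[of z] pos[of y] pos[of z] M
      by (intro mult_strict_mono') auto
    then show ?thesis
      by (simp add: sqrt_det_def M del: csqrt.simps)
  qed
  then show ?thesis
    using csqrt_unique[OF sqrt_det_power2, of A] by simp
qed

end

theory Submission
  imports Defs "HOL-Probability.Distributions"
begin

text \<open>
  Substituting \<open>w = w\<^sub>0 + u / x\<close> turns the integrand near \<open>w\<^sub>0\<close>, up to the factor
  \<open>exp (x g\<^sub>2(w\<^sub>0) - x\<^sup>2 g\<^sub>3(w\<^sub>0))\<close>, into \<open>g\<^sub>1(w\<^sub>0) exp (b \<sqdot> u - u\<^sup>T H u / 2)\<close> with an error that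
  Taylor's theorem bounds by \<open>K / x\<close> times a Gaussian, uniformly in \<open>u\<close>. Away from \<open>w\<^sub>0\<close> the real
  part of \<open>g\<^sub>3\<close> exceeds its minimum by a fixed amount, so this part of the integral is smaller than
  any power of \<open>1 / x\<close>.

  The complex Gaussian integral, with the right branch of \<open>(det H)\<^sup>1\<^sup>/\<^sup>2\<close>, comes from two differential
  equations, whose coefficients are moments computed by integration by parts: one in \<open>s\<close> for the linear
  term \<open>s b\<close>, and one along the segment \<open>H\<^sub>t = (1 - t) I + t H\<close>. The eigenvalues of \<open>H\<^sub>t\<close> are
  \<open>1 - t + t \<lambda>\<close>, so the product of their principal square roots is smooth in \<open>t\<close>, and by Jacobi's
  formula for the derivative of the determinant its product with the Gaussian integral is constant.
\<close>

section \<open>Gaussian integrals and differentiation under the integral sign\<close>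

text \<open>Nor does \<open>(sqrt_det H)\<^sup>2 = det H\<close> settle the prefactor, which it
  fixes only up to sign. Following the product of roots from \<open>I\<close>, where it is 1,
  decides the sign; this is possible because 1 - t + t z stays in the right half-plane, off the cut
  of \<open>csqrt\<close>, when Re z > 0. Near the minimum the obstacle is that the Taylor remainder
  of x^2 g3, of size |u|^3 / x, is unbounded in u. The ball is taken so small that this remainder
  costs at most half of the quadratic decay, and a fixed Gaussian then dominates for all x. Away
  from the minimum x^2 Re g3 is shared out: the multiple c2 x pays for x g2, the multiple c1 for
  integrability, and the gap acts on the rest.\<close>

lemma has_bochner_integral_gaussian_euclidean:
  fixes a :: real
  assumes a: "a > 0"
  shows "has_bochner_integral lborel (\<lambda>u::'a::euclidean_space. exp (- (a / 2) * (norm u)\<^sup>2))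
           ((2 * pi / a) powr (real DIM('a) / 2))"
proof -
  interpret product_sigma_finite "\<lambda>_. lborel :: real measure" by standard
  let ?g = "\<lambda>x::real. exp (- (a / 2) * x\<^sup>2)"
  \<comment> \<open>The standard deviation of the normal density that is proportional to
    \<open>?g\<close>.\<close>
  define \<sigma> where "\<sigma> = 1 / sqrt a"
  have \<sigma>: "\<sigma> > 0" "\<sigma>\<^sup>2 = 1 / a" using a by (auto simp: \<sigma>_def power_divide)
  have g: "?g x = normal_density 0 \<sigma> x * sqrt (2 * pi / a)" for x
  proof -
    have "sqrt (2 * pi / a) > 0" using a by simp
    moreover have "- (x\<^sup>2 / (2 * (1 / a))) = - (a / 2) * x\<^sup>2" using a by (simp add: field_simps)
    ultimately show ?thesis using a by (simp add: normal_density_def \<sigma>(2) del: real_sqrt_gt_0_iff)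
  qed
  have int1: "integrable lborel ?g"
    unfolding g using \<sigma> by (intro integrable_mult_left integrable_normal_density) auto
  have val1: "integral\<^sup>L lborel ?g = sqrt (2 * pi / a)"
    unfolding g using \<sigma> integral_normal_density[of \<sigma> 0] by simp
  let ?T = "\<lambda>f. \<Sum>b\<in>Basis. f b *\<^sub>R (b::'a)"
  have T: "?T \<in> measurable (Pi\<^sub>M Basis (\<lambda>b. lborel)) borel" by measurable
  have eq: "exp (- (a / 2) * (norm (?T f))\<^sup>2) = (\<Prod>b\<in>(Basis::'a set). ?g (f b))" for f
  proof -
    have "(norm (?T f))\<^sup>2 = (\<Sum>b\<in>(Basis::'a set). (f b)\<^sup>2)"
      unfolding power2_norm_eq_inner
      by (subst euclidean_inner) (simp add: power2_eq_square inner_sum_left inner_Basis if_distrib cong: if_cong)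
    then show ?thesis by (simp add: sum_distrib_left sum_negf[symmetric] exp_sum)
  qed
  have eq': "exp (- (a * (norm (?T f))\<^sup>2 / 2)) = (\<Prod>b\<in>(Basis::'a set). exp (- (a * (f b)\<^sup>2 / 2)))" for f
    using eq[of f] by simp
  have hb: "has_bochner_integral (Pi\<^sub>M (Basis::'a set) (\<lambda>b. lborel)) (\<lambda>f. \<Prod>b\<in>Basis. ?g (f b))
              (\<Prod>b\<in>(Basis::'a set). sqrt (2 * pi / a))"
    unfolding has_bochner_integral_iff
    using product_integrable_prod[of Basis "\<lambda>b. ?g"] product_integral_prod[of Basis "\<lambda>b. ?g"] int1 val1
    by auto
  have "(\<Prod>b\<in>(Basis::'a set). sqrt (2 * pi / a)) = (2 * pi / a) powr (real DIM('a) / 2)"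
    using a by (simp add: powr_half_sqrt_powr powr_realpow real_sqrt_power)
  with hb have "has_bochner_integral (distr (Pi\<^sub>M Basis (\<lambda>b. lborel)) borel ?T)
      (\<lambda>u::'a. exp (- (a / 2) * (norm u)\<^sup>2)) ((2 * pi / a) powr (real DIM('a) / 2))"
    unfolding has_bochner_integral_iff
    by (simp add: integrable_distr_eq[OF T] integral_distr[OF T] eq')
  then show ?thesis
    by (subst lborel_eq)
qed

lemma has_vector_derivative_iff_quotient_tendsto:
  fixes f :: "real \<Rightarrow> 'b::real_normed_vector"
  shows "(f has_vector_derivative D) (at x within S) \<longleftrightarrow>
    ((\<lambda>y. (f y - f x) /\<^sub>R (y - x)) \<longlongrightarrow> D) (at x within S)"
proof -
  have "\<forall>\<^sub>F y in at x within S. norm ((1 / norm (y - x)) *\<^sub>R (f y - (f x + (y - x) *\<^sub>R D)))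
      = norm ((f y - f x) /\<^sub>R (y - x) - D)"
    unfolding eventually_at_filter
  proof (rule always_eventually, intro allI impI)
    fix y assume "y \<noteq> x"
    then have "(f y - f x) /\<^sub>R (y - x) - D = (1 / (y - x)) *\<^sub>R (f y - (f x + (y - x) *\<^sub>R D))"
      by (simp add: diff_diff_eq[symmetric] scaleR_diff_right[of _ _ "(y - x) *\<^sub>R D"] inverse_eq_divide)
    then show "norm ((1 / norm (y - x)) *\<^sub>R (f y - (f x + (y - x) *\<^sub>R D)))
      = norm ((f y - f x) /\<^sub>R (y - x) - D)" by simp
  qed
  from tendsto_cong[OF this, of 0] show ?thesis
    unfolding has_vector_derivative_def has_derivative_within tendsto_norm_zero_iff
    using bounded_linear_scaleR_left[of D] LIM_zero_iff[of "\<lambda>y. (f y - f x) /\<^sub>R (y - x)" D "at x within S"]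
    by blast
qed

text \<open>The mean value inequality on the convex set \<open>S\<close> bounds every difference
  quotient by \<open>B\<close>, so dominated convergence applies along any sequence tending to
  \<open>t0\<close>. Working within \<open>S\<close> provides the one-sided derivatives at the ends
  of \<open>{0..1}\<close>.\<close>

lemma has_vector_derivative_lebesgue_integral:
  fixes F F' :: "real \<Rightarrow> 'a \<Rightarrow> 'b::{banach, second_countable_topology}"
  assumes S: "convex S" and t0: "t0 \<in> S"
    and int: "\<And>t. t \<in> S \<Longrightarrow> integrable M (F t)"
    and der: "\<And>t u. t \<in> S \<Longrightarrow> ((\<lambda>t. F t u) has_vector_derivative F' t u) (at t within S)"
    and meas: "F' t0 \<in> borel_measurable M"
    and bound: "\<And>t u. t \<in> S \<Longrightarrow> norm (F' t u) \<le> B u" and B: "integrable M B"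
  shows "((\<lambda>t. integral\<^sup>L M (F t)) has_vector_derivative integral\<^sup>L M (F' t0)) (at t0 within S)"
proof -
  have lip: "norm (F y u - F t0 u) \<le> B u * norm (y - t0)" if "y \<in> S" for y u
  proof (rule differentiable_bound[OF S _ _ that t0])
    fix x assume x: "x \<in> S"
    show "((\<lambda>t. F t u) has_derivative (\<lambda>h. h *\<^sub>R F' x u)) (at x within S)"
      using der[OF x, of u] by (simp add: has_vector_derivative_def)
    show "onorm (\<lambda>h. h *\<^sub>R F' x u) \<le> B u"
      by (rule onorm_le) (use mult_left_mono[OF bound[OF x, of u] abs_ge_zero] in \<open>simp add: mult.commute[of "B u"]\<close>)
  qed
  have conv: "(\<lambda>i. integral\<^sup>L M (\<lambda>u. (F (X i) u - F t0 u) /\<^sub>R (X i - t0))) \<longlonglongrightarrow> integral\<^sup>L M (F' t0)"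
    if X: "\<forall>i. X i \<in> S - {t0}" "X \<longlonglongrightarrow> t0" for X
  proof (rule integral_dominated_convergence[where w = B])
    show "F' t0 \<in> borel_measurable M" by fact
    show "(\<lambda>u. (F (X i) u - F t0 u) /\<^sub>R (X i - t0)) \<in> borel_measurable M" for i
      using X t0 int by (intro borel_measurable_scaleR borel_measurable_diff) auto
    show "integrable M B" by fact
    show "AE u in M. (\<lambda>i. (F (X i) u - F t0 u) /\<^sub>R (X i - t0)) \<longlonglongrightarrow> F' t0 u"
    proof (rule AE_I2)
      fix u
      have "((\<lambda>y. (F y u - F t0 u) /\<^sub>R (y - t0)) \<longlongrightarrow> F' t0 u) (at t0 within S)"
        using der[OF t0, of u] by (simp add: has_vector_derivative_iff_quotient_tendsto)
      then show "(\<lambda>i. (F (X i) u - F t0 u) /\<^sub>R (X i - t0)) \<longlonglongrightarrow> F' t0 u"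
        unfolding tendsto_at_iff_sequentially using X by (auto simp: o_def)
    qed
    show "AE u in M. norm ((F (X i) u - F t0 u) /\<^sub>R (X i - t0)) \<le> B u" for i
    proof (rule AE_I2)
      fix u
      have "X i \<in> S" "X i \<noteq> t0" using X(1) by auto
      with lip[of "X i" u] show "norm ((F (X i) u - F t0 u) /\<^sub>R (X i - t0)) \<le> B u"
        by (simp add: inverse_eq_divide pos_divide_le_eq)
    qed
  qed
  have diff: "integral\<^sup>L M (\<lambda>u. (F y u - F t0 u) /\<^sub>R (y - t0))
      = (integral\<^sup>L M (F y) - integral\<^sup>L M (F t0)) /\<^sub>R (y - t0)" if "y \<in> S" for y
    using int[OF that] int[OF t0] by (simp add: Bochner_Integration.integral_diff)
  show ?thesis
    unfolding has_vector_derivative_iff_quotient_tendsto tendsto_at_iff_sequentially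
  proof (intro allI impI)
    fix X assume X: "\<forall>i. X i \<in> S - {t0}" "X \<longlonglongrightarrow> t0"
    have XS: "X i \<in> S" for i using X by auto
    show "((\<lambda>y. (integral\<^sup>L M (F y) - integral\<^sup>L M (F t0)) /\<^sub>R (y - t0)) \<circ> X)
        \<longlonglongrightarrow> integral\<^sup>L M (F' t0)"
      using conv[OF X] by (simp only: diff[OF XS] o_def)
  qed
qed

section \<open>Moments of Gaussians with complex coefficients\<close>

text \<open>Complex coefficients and a real argument, without conjugation: this is the form of the
  derivative of a complex-valued function on real space, and \<open>lin (gradient f w)\<close> will
  be the Frechet derivative of \<open>f\<close>.\<close>

definition lin :: "complex^'n \<Rightarrow> real^'n \<Rightarrow> complex"
  where "lin b u = (\<Sum>i\<in>UNIV. b $ i * of_real (u $ i))"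

definition quad :: "complex^'n^'n \<Rightarrow> real^'n \<Rightarrow> complex"
  where "quad A u = (\<Sum>i\<in>UNIV. \<Sum>j\<in>UNIV. A $ i $ j * of_real (u $ i * u $ j))"

definition gexp :: "complex^'n^'n \<Rightarrow> complex^'n \<Rightarrow> real^'n \<Rightarrow> complex"
  where "gexp A b u = exp (lin b u - quad A u / 2)"

lemma norm_lin_le: "norm (lin b u) \<le> (\<Sum>i\<in>UNIV. norm (b $ i)) * norm u"
  unfolding lin_def sum_distrib_right
  by (rule sum_norm_le) (auto simp: norm_mult component_le_norm_cart intro!: mult_left_mono)

lemma norm_quad_le: "norm (quad A u) \<le> (\<Sum>i\<in>UNIV. \<Sum>j\<in>UNIV. norm (A $ i $ j)) * (norm u)\<^sup>2"
  unfolding quad_def sum_distrib_right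
  by (intro sum_norm_le) (auto simp: norm_mult component_le_norm_cart power2_eq_square abs_mult
      intro!: mult_left_mono mult_mono)

lemma continuous_on_lin [continuous_intros]: "continuous_on S (lin b)"
  unfolding lin_def by (intro continuous_intros)

lemma continuous_on_quad [continuous_intros]: "continuous_on S (quad A)"
  unfolding quad_def by (intro continuous_intros)

lemma continuous_on_gexp [continuous_intros]: "continuous_on S (gexp A b)"
  unfolding gexp_def by (intro continuous_intros) auto

lemma borel_measurable_gexp [measurable]: "gexp A b \<in> borel_measurable borel"
  "lin b \<in> borel_measurable borel" "quad A \<in> borel_measurable borel"
  by (auto intro!: borel_measurable_continuous_onI continuous_intros)

text \<open>Since 1 + y \<le> exp y, the polynomial merely changes \<open>L\<close> to k + L; half
  of the quadratic term then absorbs the linear one by completing a square. The variable is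
  \<open>norm u\<close> near the minimum and \<open>x\<close> itself in the tail.\<close>

lemma poly_exp_le_gaussian:
  fixes y \<epsilon> L :: real
  assumes "y \<ge> 0" "\<epsilon> > 0"
  shows "(1 + y) ^ k * exp (L * y - \<epsilon> * y\<^sup>2) \<le> exp ((k + L)\<^sup>2 / (2 * \<epsilon>)) * exp (- (\<epsilon> / 2) * y\<^sup>2)"
proof -
  have "(1 + y) ^ k \<le> exp y ^ k"
    using assms exp_ge_add_one_self[of y] by (intro power_mono) auto
  then have "(1 + y) ^ k * exp (L * y - \<epsilon> * y\<^sup>2) \<le> exp (k * y) * exp (L * y - \<epsilon> * y\<^sup>2)"
    by (simp add: exp_of_nat_mult)
  also have "\<dots> = exp ((k + L) * y - (\<epsilon> / 2) * y\<^sup>2) * exp (- (\<epsilon> / 2) * y\<^sup>2)"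
    by (simp add: exp_add[symmetric] algebra_simps)
  also have "(k + L) * y - (\<epsilon> / 2) * y\<^sup>2 \<le> (k + L)\<^sup>2 / (2 * \<epsilon>)"
  proof -
    have "0 \<le> (\<epsilon> * y - (k + L))\<^sup>2" by simp
    then have "((k + L) * y - (\<epsilon> / 2) * y\<^sup>2) * (2 * \<epsilon>) \<le> (k + L)\<^sup>2"
      by (simp add: power2_eq_square algebra_simps)
    then show ?thesis using assms by (simp add: pos_le_divide_eq)
  qed
  finally show ?thesis by simp
qed

text \<open>\<open>L\<close> is kept apart from \<open>b\<close> so that one bound covers a family
  of linear terms, such as s b for s in \<open>{0..1}\<close>. The rate drops to a quarter of
  \<epsilon>: one half is the factor in the exponent of \<open>gexp\<close>, the other is spent on
  the linear term.\<close>

lemma gexp_bound: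
  assumes eps: "\<epsilon> > 0" and co: "\<epsilon> * (norm u)\<^sup>2 \<le> Re (quad A u)" and L: "norm (lin b u) \<le> L * norm u"
  shows "(1 + norm u) ^ k * norm (gexp A b u)
    \<le> exp ((k + L)\<^sup>2 / \<epsilon>) * exp (- (\<epsilon> / 4) * (norm u)\<^sup>2)"
proof -
  have "Re (lin b u - quad A u / 2) \<le> L * norm u - \<epsilon> / 2 * (norm u)\<^sup>2"
    using co L complex_Re_le_cmod[of "lin b u"] by simp
  then have "norm (gexp A b u) \<le> exp (L * norm u - \<epsilon> / 2 * (norm u)\<^sup>2)"
    by (simp add: gexp_def)
  then have "(1 + norm u) ^ k * norm (gexp A b u)
     \<le> (1 + norm u) ^ k * exp (L * norm u - \<epsilon> / 2 * (norm u)\<^sup>2)"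
    by (intro mult_left_mono) auto
  also have "\<dots> \<le> exp ((k + L)\<^sup>2 / (2 * (\<epsilon>/2))) * exp (- (\<epsilon>/2 / 2) * (norm u)\<^sup>2)"
    using eps by (intro poly_exp_le_gaussian) auto
  finally show ?thesis by simp
qed

lemma integrable_gaussian:
  "a > 0 \<Longrightarrow> integrable lborel (\<lambda>u::'a::euclidean_space. C * exp (- a * (norm u)\<^sup>2) :: real)"
  using has_bochner_integral_gaussian_euclidean[of "2 * a", where 'a = 'a]
  by (auto simp: has_bochner_integral_iff)

lemma integrable_poly_gexp:
  fixes f :: "real^'n \<Rightarrow> complex"
  assumes eps: "\<epsilon> > 0" and co: "\<And>u. \<epsilon> * (norm u)\<^sup>2 \<le> Re (quad A u)"
    and f [measurable]: "f \<in> borel_measurable borel"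
    and bd: "\<And>u. norm (f u) \<le> C * (1 + norm u) ^ k"
  shows "integrable lborel (\<lambda>u. f u * gexp A b u)"
proof (rule Bochner_Integration.integrable_bound)
  let ?L = "\<Sum>i\<in>UNIV. norm (b $ i)"
  let ?B = "\<lambda>u::real^'n. (\<bar>C\<bar> * exp ((k + ?L)\<^sup>2 / \<epsilon>)) * exp (- (\<epsilon> / 4) * (norm u)\<^sup>2)"
  show "integrable lborel ?B"
    using eps by (intro integrable_gaussian) auto
  show "(\<lambda>u. f u * gexp A b u) \<in> borel_measurable lborel" by measurable
  show "AE u in lborel. norm (f u * gexp A b u) \<le> norm (?B u)"
  proof (rule AE_I2)
    fix u
    have "norm (f u * gexp A b u) \<le> \<bar>C\<bar> * (1 + norm u) ^ k * norm (gexp A b u)"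
      unfolding norm_mult using bd[of u]
      by (intro mult_right_mono order_trans[OF bd[of u]]) auto
    also have "\<dots> \<le> ?B u"
      using mult_left_mono[OF gexp_bound[OF eps co norm_lin_le, of u k b], of "\<bar>C\<bar>"]
      by (simp add: mult.assoc)
    finally show "norm (f u * gexp A b u) \<le> norm (?B u)" by simp
  qed
qed

lemma lborel_integral_translation:
  fixes f :: "'a::euclidean_space \<Rightarrow> 'b::{banach, second_countable_topology}"
  assumes f: "f \<in> borel_measurable borel"
  shows "integral\<^sup>L lborel (\<lambda>u. f (u + c)) = integral\<^sup>L lborel f"
    and "integrable lborel f \<Longrightarrow> integrable lborel (\<lambda>u. f (u + c))"
proof -
  have d: "distr lborel borel ((+) c) = lborel" by (rule lborel_distr_plus)
  have m: "(+) c \<in> measurable lborel borel" by simp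
  show "integral\<^sup>L lborel (\<lambda>u. f (u + c)) = integral\<^sup>L lborel f"
    using integral_distr[OF m f] unfolding d by (simp add: add.commute)
  show "integrable lborel (\<lambda>u. f (u + c))" if "integrable lborel f"
    using integrable_distr_eq[OF m f] that unfolding d by (simp add: add.commute)
qed

text \<open>By translation invariance the integral of \<open>f (u + t *\<^sub>R e)\<close> does not depend on \<open>t\<close>;
  differentiate at \<open>t = 0\<close>.\<close>

lemma integral_directional_derivative_eq_0:
  fixes f f' :: "'a::euclidean_space \<Rightarrow> complex"
  assumes f: "integrable lborel f" and f': "f' \<in> borel_measurable borel"
    and der: "\<And>u. ((\<lambda>t. f (u + t *\<^sub>R e)) has_vector_derivative f' u) (at 0)"
    and eps: "\<epsilon> > 0" and bd: "\<And>u. norm (f' u) \<le> C * exp (- \<epsilon> * (norm u)\<^sup>2)"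
  shows "integral\<^sup>L lborel f' = 0"
proof -
  have fm: "f \<in> borel_measurable borel" using f by auto
  have C: "C \<ge> 0"
    using order_trans[OF norm_ge_zero bd[of 0]] by simp
  \<comment> \<open>Dominates the shifts of \<open>f'\<close> by t e for all |t| \<le> 1 at once, by
    |u|^2 \<le> 2 |u + t e|^2 + 2 |e|^2; hence the halved rate.\<close>
  let ?B = "\<lambda>u. (C * exp (\<epsilon> * (norm e)\<^sup>2)) * exp (- (\<epsilon> / 2) * (norm u)\<^sup>2)"
  have bd': "norm (f' (u + t *\<^sub>R e)) \<le> ?B u" if t: "t \<in> {-1..1}" for t u
  proof -
    have te: "norm (t *\<^sub>R e) \<le> norm e" using t by (simp add: mult_left_le_one_le abs_le_iff)
    have "norm u \<le> norm (u + t *\<^sub>R e) + norm (t *\<^sub>R e)"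
      by (metis add_diff_cancel_right' norm_triangle_ineq4)
    then have "(norm u)\<^sup>2 \<le> (norm (u + t *\<^sub>R e) + norm (t *\<^sub>R e))\<^sup>2"
      by (intro power_mono) auto
    also have "\<dots> \<le> 2 * (norm (u + t *\<^sub>R e))\<^sup>2 + 2 * (norm (t *\<^sub>R e))\<^sup>2"
      using sum_squares_bound[of "norm (u + t *\<^sub>R e)" "norm (t *\<^sub>R e)"] by (simp add: power2_sum)
    also have "(norm (t *\<^sub>R e))\<^sup>2 \<le> (norm e)\<^sup>2" using te by (intro power_mono) auto
    finally have "- \<epsilon> * (norm (u + t *\<^sub>R e))\<^sup>2 \<le> \<epsilon> * (norm e)\<^sup>2 + - (\<epsilon>/2) * (norm u)\<^sup>2"
      using mult_left_mono[of "(norm u)\<^sup>2" "2 * (norm (u + t *\<^sub>R e))\<^sup>2 + 2 * (norm e)\<^sup>2" \<epsilon>] eps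
      by (simp add: algebra_simps)
    then have "exp (- \<epsilon> * (norm (u + t *\<^sub>R e))\<^sup>2) \<le> exp (\<epsilon> * (norm e)\<^sup>2) * exp (- (\<epsilon>/2) * (norm u)\<^sup>2)"
      unfolding exp_add[symmetric] by simp
    then have "C * exp (- \<epsilon> * (norm (u + t *\<^sub>R e))\<^sup>2) \<le> ?B u"
      using C by (simp only: mult.assoc mult_left_mono)
    with bd[of "u + t *\<^sub>R e"] show ?thesis by linarith
  qed
  have "((\<lambda>t. integral\<^sup>L lborel (\<lambda>u. f (u + t *\<^sub>R e))) has_vector_derivative
      integral\<^sup>L lborel (\<lambda>u. f' (u + 0 *\<^sub>R e))) (at 0 within {-1..1})"
  proof (rule has_vector_derivative_lebesgue_integral[where F' = "\<lambda>t u. f' (u + t *\<^sub>R e)" and B = ?B])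
    show "integrable lborel (\<lambda>u. f (u + t *\<^sub>R e))" for t
      by (rule lborel_integral_translation) (use f fm in auto)
    show "((\<lambda>t. f (u + t *\<^sub>R e)) has_vector_derivative f' (u + t *\<^sub>R e)) (at t within {-1..1})" for t u
    proof -
      have "((\<lambda>s. f ((u + t *\<^sub>R e) + s *\<^sub>R e)) has_vector_derivative f' (u + t *\<^sub>R e)) (at (t - t))"
        using der[of "u + t *\<^sub>R e"] by simp
      from vector_diff_chain_at[of "\<lambda>s. s - t" 1 t, OF _ this]
      have "((\<lambda>s. f ((u + t *\<^sub>R e) + (s - t) *\<^sub>R e)) has_vector_derivative f' (u + t *\<^sub>R e)) (at t)"
        by (simp add: o_def has_vector_derivative_diff_const has_vector_derivative_id)
      then show ?thesis
        by (simp add: algebra_simps has_vector_derivative_at_within)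
    qed
    show "integrable lborel ?B" using eps by (intro integrable_gaussian) auto
  qed (use bd' f' in auto)
  then have "((\<lambda>t::real. integral\<^sup>L lborel f) has_vector_derivative integral\<^sup>L lborel f') (at 0 within {-1..1})"
    by (simp add: lborel_integral_translation(1)[OF fm])
  moreover have "((\<lambda>t::real. integral\<^sup>L lborel f) has_vector_derivative 0) (at 0 within {-1..1})"
    by (rule has_vector_derivative_const)
  ultimately show ?thesis
    by (rule vector_derivative_unique_within[rotated]) (simp add: at_within_Icc_at)
qed

lemma lin_add_axis: "lin b (u + t *\<^sub>R axis i 1) = lin b u + of_real t * b $ i"
proof -
  have "lin b (u + t *\<^sub>R axis i 1) = (\<Sum>j\<in>UNIV. b $ j * of_real (u $ j) + (if j = i then of_real t * b $ j else 0))"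
    unfolding lin_def by (rule sum.cong) (auto simp: axis_def algebra_simps)
  then show ?thesis by (simp add: sum.distrib lin_def)
qed

lemma quad_add_axis:
  assumes sym: "\<And>i j. A $ i $ j = A $ j $ i"
  shows "quad A (u + t *\<^sub>R axis i 1) = quad A u + 2 * of_real t * lin (A $ i) u + of_real (t\<^sup>2) * A $ i $ i"
proof -
  have q: "quad A u = (\<Sum>j\<in>UNIV. of_real (u $ j) * lin (A $ j) u)" for u
    unfolding quad_def lin_def sum_distrib_left by (intro sum.cong) (auto simp: algebra_simps)
  have "quad A (u + t *\<^sub>R axis i 1)
     = (\<Sum>j\<in>UNIV. (of_real (u $ j) * lin (A $ j) u + of_real t * (A $ j $ i * of_real (u $ j)))
          + (if j = i then of_real t * lin (A $ j) u + of_real (t\<^sup>2) * A $ j $ i else 0))"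
    unfolding q lin_add_axis by (rule sum.cong) (auto simp: axis_def algebra_simps power2_eq_square)
  also have "\<dots> = quad A u + of_real t * (\<Sum>j\<in>UNIV. A $ j $ i * of_real (u $ j))
      + (of_real t * lin (A $ i) u + of_real (t\<^sup>2) * A $ i $ i)"
    by (simp add: sum.distrib q sum_distrib_left)
  also have "(\<Sum>j\<in>UNIV. A $ j $ i * of_real (u $ j)) = lin (A $ i) u"
    unfolding lin_def by (intro sum.cong) (auto simp: sym)
  finally show ?thesis by (simp add: algebra_simps)
qed

lemma gexp_has_vector_derivative_axis:
  assumes sym: "\<And>i j. A $ i $ j = A $ j $ i"
  shows "((\<lambda>t. gexp A b (u + t *\<^sub>R axis i 1)) has_vector_derivative
    (b $ i - lin (A $ i) u) * gexp A b u) (at 0)"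
proof -
  \<comment> \<open>Along the axis the exponent is a polynomial, so it is differentiated as a
    holomorphic function of z and then restricted to real t.\<close>
  let ?e = "\<lambda>z. (lin b u + z * b $ i) - (quad A u + 2 * z * lin (A $ i) u + z\<^sup>2 * A $ i $ i) / 2"
  have "((\<lambda>z. exp (?e z)) has_field_derivative (b $ i - lin (A $ i) u) * gexp A b u) (at (of_real 0))"
    unfolding gexp_def by (rule derivative_eq_intros refl | simp)+
  from has_vector_derivative_real_field[OF this]
  show ?thesis
    by (simp add: gexp_def lin_add_axis quad_add_axis[OF sym])
qed

text \<open>The integrand is the derivative of \<open>p u * gexp A b u\<close> in direction i, and
  such a derivative has integral zero. Polynomial growth of \<open>p\<close> and \<open>p'\<close>
  supplies the Gaussian bound that this requires.\<close>

lemma gexp_integration_by_parts: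
  fixes p p' :: "real^'n \<Rightarrow> complex"
  assumes sym: "\<And>i j. A $ i $ j = A $ j $ i"
    and eps: "\<epsilon> > 0" and co: "\<And>u. \<epsilon> * (norm u)\<^sup>2 \<le> Re (quad A u)"
    and meas [measurable]: "p \<in> borel_measurable borel" "p' \<in> borel_measurable borel"
    and bd: "\<And>u. norm (p u) \<le> C * (1 + norm u) ^ k" "\<And>u. norm (p' u) \<le> C * (1 + norm u) ^ k"
    and der: "\<And>u. ((\<lambda>t. p (u + t *\<^sub>R axis i 1)) has_vector_derivative p' u) (at 0)"
  shows "integral\<^sup>L lborel (\<lambda>u. (p' u + p u * (b $ i - lin (A $ i) u)) * gexp A b u) = 0"
proof (rule integral_directional_derivative_eq_0)
  let ?L = "\<Sum>i\<in>UNIV. norm (b $ i)"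
  let ?K = "norm (b $ i) + (\<Sum>j\<in>UNIV. norm (A $ i $ j))"
  have C: "C \<ge> 0" using order_trans[OF norm_ge_zero bd(1)[of 0]] by simp
  show "integrable lborel (\<lambda>u. p u * gexp A b u)"
    by (rule integrable_poly_gexp[OF eps co meas(1) bd(1)])
  show "(\<lambda>u. (p' u + p u * (b $ i - lin (A $ i) u)) * gexp A b u) \<in> borel_measurable borel"
    by measurable
  show "((\<lambda>t. p (u + t *\<^sub>R axis i 1) * gexp A b (u + t *\<^sub>R axis i 1)) has_vector_derivative
      (p' u + p u * (b $ i - lin (A $ i) u)) * gexp A b u) (at 0)" for u
    using has_vector_derivative_mult[OF der[of u] gexp_has_vector_derivative_axis[OF sym, of b u i]]
    by (simp add: algebra_simps)
  show "\<epsilon> / 4 > 0" using eps by simp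
  fix u
  have K: "norm (b $ i - lin (A $ i) u) \<le> ?K * (1 + norm u)"
  proof -
    have "norm (b $ i - lin (A $ i) u) \<le> norm (b $ i) + (\<Sum>j\<in>UNIV. norm (A $ i $ j)) * norm u"
      by (rule order_trans[OF norm_triangle_ineq4]) (simp add: norm_lin_le)
    also have "\<dots> \<le> ?K * (1 + norm u)"
      by (simp add: algebra_simps sum_nonneg)
    finally show ?thesis .
  qed
  have "norm (p' u + p u * (b $ i - lin (A $ i) u))
      \<le> C * (1 + norm u) ^ k + (C * (1 + norm u) ^ k) * (?K * (1 + norm u))"
    by (rule order_trans[OF norm_triangle_ineq])
       (use bd C K in \<open>auto simp: norm_mult intro!: add_mono mult_mono\<close>)
  also have "\<dots> \<le> (C * (1 + norm u) ^ k) * (1 + norm u) + (C * (1 + norm u) ^ k) * (?K * (1 + norm u))"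
    using mult_left_mono[of 1 "1 + norm u" "C * (1 + norm u) ^ k"] C by simp
  also have "\<dots> = (C * (1 + ?K)) * (1 + norm u) ^ Suc k"
    by (simp add: algebra_simps)
  finally have "norm ((p' u + p u * (b $ i - lin (A $ i) u)) * gexp A b u)
      \<le> (C * (1 + ?K)) * (1 + norm u) ^ Suc k * norm (gexp A b u)"
    unfolding norm_mult by (rule mult_right_mono) auto
  also have "\<dots> \<le> (C * (1 + ?K)) * (exp ((Suc k + ?L)\<^sup>2 / \<epsilon>) * exp (- (\<epsilon> / 4) * (norm u)\<^sup>2))"
    unfolding mult.assoc[of "C * (1 + ?K)"]
    using C gexp_bound[OF eps co norm_lin_le, of u "Suc k" b]
    by (intro mult_left_mono) (auto simp: sum_nonneg add_nonneg_nonneg)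
  finally show "norm ((p' u + p u * (b $ i - lin (A $ i) u)) * gexp A b u)
      \<le> (C * (1 + ?K)) * exp ((Suc k + ?L)\<^sup>2 / \<epsilon>) * exp (- (\<epsilon> / 4) * (norm u)\<^sup>2)"
    by (simp only: mult.assoc)
qed

lemma component_le_1_add_norm: "\<bar>u $ i\<bar> \<le> 1 * (1 + norm (u::real^'n)) ^ 1"
  using component_le_norm_cart[of u i] by simp

text \<open>The two systems come from integration by parts with p = 1 and with p = u_j. Writing G
  for the integral of the Gaussian, they say A m = G b for the vector of first moments and, when b =
  0, A M = G I for the matrix of second moments.\<close>

lemma gexp_moments:
  fixes A :: "complex^'n^'n"
  assumes sym: "\<And>i j. A $ i $ j = A $ j $ i"
    and eps: "\<epsilon> > 0" and co: "\<And>u. \<epsilon> * (norm u)\<^sup>2 \<le> Re (quad A u)"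
  shows "integrable lborel (gexp A b)"
    and "integrable lborel (\<lambda>u. of_real (u $ i) * gexp A b u)"
    and "integrable lborel (\<lambda>u. of_real (u $ i * u $ j) * gexp A b u)"
    and "(\<Sum>k\<in>UNIV. A $ i $ k * integral\<^sup>L lborel (\<lambda>u. of_real (u $ k) * gexp A b u))
          = b $ i * integral\<^sup>L lborel (gexp A b)"
    and "(\<Sum>k\<in>UNIV. A $ i $ k * integral\<^sup>L lborel (\<lambda>u. of_real (u $ k * u $ j) * gexp A 0 u))
          = (if i = j then integral\<^sup>L lborel (gexp A 0) else 0)"
proof -
  note int = integrable_poly_gexp[OF eps co]
  show int0: "integrable lborel (gexp A b)" for b
    using int[of "\<lambda>u. 1" 1 0 b] by simp
  show int1: "integrable lborel (\<lambda>u. of_real (u $ i) * gexp A b u)" for i b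
    by (rule int[where C = 1 and k = 1]) (use component_le_1_add_norm in \<open>auto\<close>)
  show int2: "integrable lborel (\<lambda>u. of_real (u $ i * u $ j) * gexp A b u)" for i j b
  proof (rule int[where C = 1 and k = 2])
    fix u :: "real^'n"
    show "norm (complex_of_real (u $ i * u $ j)) \<le> 1 * (1 + norm u)\<^sup>2"
      unfolding norm_of_real abs_mult power2_eq_square using component_le_1_add_norm[of u]
      by (simp add: mult_mono)
  qed auto
  have lin_eq: "lin (A $ i) u * g = (\<Sum>k\<in>UNIV. A $ i $ k * (of_real (u $ k) * g))" for u i and g :: complex
    unfolding lin_def sum_distrib_right by (simp add: mult.assoc)
  have intlin: "integrable lborel (\<lambda>u. lin (A $ i) u * gexp A b u)" for i b
    unfolding lin_eq by (intro Bochner_Integration.integrable_sum integrable_mult_right int1)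
  have "0 = integral\<^sup>L lborel (\<lambda>u. (0 + 1 * (b $ i - lin (A $ i) u)) * gexp A b u)"
    by (rule HOL.sym, rule gexp_integration_by_parts[OF assms(1) eps co, where k = 0 and C = 1]) auto
  also have "\<dots> = integral\<^sup>L lborel (\<lambda>u. b $ i * gexp A b u - lin (A $ i) u * gexp A b u)"
    by (simp add: algebra_simps)
  also have "\<dots> = b $ i * integral\<^sup>L lborel (gexp A b) - integral\<^sup>L lborel (\<lambda>u. lin (A $ i) u * gexp A b u)"
    using int0 intlin by (simp add: Bochner_Integration.integral_diff)
  also have "integral\<^sup>L lborel (\<lambda>u. lin (A $ i) u * gexp A b u)
      = (\<Sum>k\<in>UNIV. A $ i $ k * integral\<^sup>L lborel (\<lambda>u. of_real (u $ k) * gexp A b u))"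
    unfolding lin_eq by (simp add: Bochner_Integration.integral_sum int1)
  finally show "(\<Sum>k\<in>UNIV. A $ i $ k * integral\<^sup>L lborel (\<lambda>u. of_real (u $ k) * gexp A b u))
          = b $ i * integral\<^sup>L lborel (gexp A b)" by simp
  let ?d = "if i = j then 1 else 0 :: complex"
  have linj_eq: "of_real (u $ j) * lin (A $ i) u * g = (\<Sum>k\<in>UNIV. A $ i $ k * (of_real (u $ k * u $ j) * g))"
    for u and g :: complex
    unfolding lin_def sum_distrib_right sum_distrib_left by (intro sum.cong) (auto simp: algebra_simps)
  have intlinj: "integrable lborel (\<lambda>u. of_real (u $ j) * lin (A $ i) u * gexp A 0 u)"
    unfolding linj_eq by (intro Bochner_Integration.integrable_sum integrable_mult_right int2)
  have "0 = integral\<^sup>L lborel (\<lambda>u. (?d + of_real (u $ j) * (0 $ i - lin (A $ i) u)) * gexp A 0 u)"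
  proof (rule HOL.sym, rule gexp_integration_by_parts[OF assms(1) eps co, where k = 1 and C = 1])
    fix u :: "real^'n"
    show "norm ?d \<le> 1 * (1 + norm u) ^ 1" by auto
    show "norm (complex_of_real (u $ j)) \<le> 1 * (1 + norm u) ^ 1"
      using component_le_1_add_norm[of u j] by simp
    have "((\<lambda>t. u $ j + t * (if i = j then 1 else 0)) has_real_derivative (if i = j then 1 else 0)) (at 0)"
      by (rule derivative_eq_intros refl | simp)+
    then have "((\<lambda>t. complex_of_real (u $ j + t * (if i = j then 1 else 0))) has_vector_derivative
        of_real (if i = j then 1 else 0)) (at 0)"
      by (rule has_vector_derivative_of_real)
    then show "((\<lambda>t. complex_of_real ((u + t *\<^sub>R axis i 1) $ j)) has_vector_derivative ?d) (at 0)"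
      by (simp add: axis_def if_distrib cong: if_cong)
  qed auto
  also have "\<dots> = integral\<^sup>L lborel (\<lambda>u. ?d * gexp A 0 u - of_real (u $ j) * lin (A $ i) u * gexp A 0 u)"
    by (simp add: algebra_simps)
  also have "\<dots> = ?d * integral\<^sup>L lborel (gexp A 0)
      - integral\<^sup>L lborel (\<lambda>u. of_real (u $ j) * lin (A $ i) u * gexp A 0 u)"
    using int0 intlinj by (subst Bochner_Integration.integral_diff) auto
  also have "integral\<^sup>L lborel (\<lambda>u. of_real (u $ j) * lin (A $ i) u * gexp A 0 u)
      = (\<Sum>k\<in>UNIV. A $ i $ k * integral\<^sup>L lborel (\<lambda>u. of_real (u $ k * u $ j) * gexp A 0 u))"
    unfolding linj_eq by (subst Bochner_Integration.integral_sum) (auto intro!: int2[simplified])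
  finally show "(\<Sum>k\<in>UNIV. A $ i $ k * integral\<^sup>L lborel (\<lambda>u. of_real (u $ k * u $ j) * gexp A 0 u))
          = (if i = j then integral\<^sup>L lborel (gexp A 0) else 0)" by auto
qed

lemma matrix_inv_nonzero_det:
  fixes A :: "'a::field^'n^'n"
  assumes "det A \<noteq> 0"
  shows "A ** matrix_inv A = mat 1" "matrix_inv A ** A = mat 1"
proof -
  have "invertible A" using assms by (simp add: invertible_det_nz)
  then have "A ** matrix_inv A = mat 1 \<and> matrix_inv A ** A = mat 1"
    unfolding matrix_inv_def invertible_def by (rule someI_ex)
  then show "A ** matrix_inv A = mat 1" "matrix_inv A ** A = mat 1" by auto
qed

text \<open>Let \<phi>(s) be the integral with linear term s b, and \<kappa> the bilinear product of
  b with A^{-1} b. The first moments give \<phi>' = s \<kappa> \<phi>, so \<phi>(s) exp (- s^2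
  \<kappa> / 2) is constant on \<open>{0..1}\<close>, and its values at the two ends are
  compared.\<close>

lemma gexp_integral_shift:
  fixes A :: "complex^'n^'n"
  assumes sym: "\<And>i j. A $ i $ j = A $ j $ i"
    and eps: "\<epsilon> > 0" and co: "\<And>u. \<epsilon> * (norm u)\<^sup>2 \<le> Re (quad A u)"
    and det: "det A \<noteq> 0"
  shows "integral\<^sup>L lborel (gexp A b)
    = integral\<^sup>L lborel (gexp A 0) * exp (bilin_dot b (matrix_inv A *v b) / 2)"
proof -
  define c where "c = matrix_inv A *v b"
  have c: "A *v c = b"
    unfolding c_def matrix_vector_mul_assoc matrix_inv_nonzero_det(1)[OF det] by simp
  define \<kappa> where "\<kappa> = bilin_dot b c"
  define sb where "sb = (\<lambda>s::real. (\<chi> i. of_real s * b $ i))"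
  define \<phi> where "\<phi> = (\<lambda>s. integral\<^sup>L lborel (gexp A (sb s)))"
  let ?L = "\<Sum>i\<in>UNIV. norm (b $ i)"
  have lin_sb: "lin (sb s) u = of_real s * lin b u" for s u
    unfolding lin_def sb_def sum_distrib_left by (simp add: mult.assoc)
  have lin_b: "lin b u * g = (\<Sum>i\<in>UNIV. b $ i * (of_real (u $ i) * g))" for u and g :: complex
    unfolding lin_def sum_distrib_right by (simp add: mult.assoc)
  note mom = gexp_moments[OF sym eps co]
  \<comment> \<open>Symmetry moves \<open>A\<close> from c to the moments: b . m = (A c) . m = c .
    (A m), and A m equals s \<phi>(s) b.\<close>
  have mom_lin: "integral\<^sup>L lborel (\<lambda>u. lin b u * gexp A (sb s) u) = of_real s * \<kappa> * \<phi> s" for s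
  proof -
    let ?m = "\<lambda>i. integral\<^sup>L lborel (\<lambda>u. of_real (u $ i) * gexp A (sb s) u)"
    have "integral\<^sup>L lborel (\<lambda>u. lin b u * gexp A (sb s) u) = (\<Sum>i\<in>UNIV. b $ i * ?m i)"
      unfolding lin_b by (simp add: Bochner_Integration.integral_sum mom(2))
    also have "\<dots> = (\<Sum>i\<in>UNIV. (\<Sum>k\<in>UNIV. A $ i $ k * c $ k) * ?m i)"
      by (simp add: c[symmetric] matrix_vector_mult_def)
    also have "\<dots> = (\<Sum>k\<in>UNIV. \<Sum>i\<in>UNIV. A $ i $ k * c $ k * ?m i)"
      unfolding sum_distrib_right by (rule sum.swap)
    also have "\<dots> = (\<Sum>k\<in>UNIV. c $ k * (\<Sum>i\<in>UNIV. A $ k $ i * ?m i))"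
      unfolding sum_distrib_left by (intro sum.cong refl) (simp add: sym mult_ac)
    also have "\<dots> = (\<Sum>k\<in>UNIV. of_real s * (b $ k * c $ k) * \<phi> s)"
      unfolding mom(4) \<phi>_def by (intro sum.cong refl) (simp add: sb_def mult_ac)
    also have "\<dots> = of_real s * \<kappa> * \<phi> s"
      unfolding \<kappa>_def bilin_dot_def by (simp add: sum_distrib_left sum_distrib_right)
    finally show ?thesis .
  qed
  have der: "(\<phi> has_vector_derivative of_real s * \<kappa> * \<phi> s) (at s within {0..1})" if s: "s \<in> {0..1}" for s
  proof -
    let ?B = "\<lambda>u::real^'n. (?L * exp ((1 + ?L)\<^sup>2 / \<epsilon>)) * exp (- (\<epsilon> / 4) * (norm u)\<^sup>2)"
    have "(\<phi> has_vector_derivative integral\<^sup>L lborel (\<lambda>u. lin b u * gexp A (sb s) u)) (at s within {0..1})"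
      unfolding \<phi>_def
    proof (rule has_vector_derivative_lebesgue_integral[where F' = "\<lambda>s u. lin b u * gexp A (sb s) u" and B = ?B])
      show "integrable lborel (gexp A (sb t))" for t by (rule mom)
      show "integrable lborel ?B" using eps by (intro integrable_gaussian) auto
      show "((\<lambda>t. gexp A (sb t) u) has_vector_derivative lin b u * gexp A (sb t) u) (at t within {0..1})" for t u
      proof -
        have "((\<lambda>z. exp (z * lin b u - quad A u / 2)) has_field_derivative lin b u * gexp A (sb t) u) (at (of_real t))"
          unfolding gexp_def lin_sb by (rule derivative_eq_intros refl | simp)+
        from has_vector_derivative_real_field[OF this] show ?thesis
          by (simp add: gexp_def lin_sb)
      qed
      show "norm (lin b u * gexp A (sb t) u) \<le> ?B u" if t: "t \<in> {0..1}" for t u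
      proof -
        have "norm (lin (sb t) u) \<le> 1 * norm (lin b u)"
          unfolding lin_sb norm_mult using t by (intro mult_right_mono) auto
        also have "\<dots> \<le> ?L * norm u" using norm_lin_le[of b u] by simp
        finally have l: "norm (lin (sb t) u) \<le> ?L * norm u" .
        have "norm (lin b u * gexp A (sb t) u) \<le> (?L * (1 + norm u)) * norm (gexp A (sb t) u)"
          unfolding norm_mult using norm_lin_le[of b u] mult_left_mono[of "norm u" "1 + norm u" ?L]
          by (intro mult_right_mono) (auto simp: sum_nonneg)
        also have "\<dots> \<le> ?L * (exp ((1 + ?L)\<^sup>2 / \<epsilon>) * exp (- (\<epsilon> / 4) * (norm u)\<^sup>2))"
          using gexp_bound[OF eps co l, of 1] mult_left_mono[of _ _ ?L]
          by (simp add: mult.assoc sum_nonneg)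
        finally show ?thesis by (simp only: mult.assoc)
      qed
    qed (use s in auto)
    then show ?thesis unfolding mom_lin .
  qed
  have const: "((\<lambda>s. \<phi> s * exp (- (of_real s)\<^sup>2 * \<kappa> / 2)) has_vector_derivative 0) (at s within {0..1})"
    if s: "s \<in> {0..1}" for s
  proof -
    have "((\<lambda>z. exp (- z\<^sup>2 * \<kappa> / 2)) has_field_derivative - of_real s * \<kappa> * exp (- (of_real s)\<^sup>2 * \<kappa> / 2)) (at (of_real s))"
      by (rule derivative_eq_intros refl | simp)+
    from has_vector_derivative_mult[OF der[OF s] has_vector_derivative_real_field[OF this]]
    show ?thesis by (simp add: algebra_simps)
  qed
  obtain C where C: "\<And>s. s \<in> {0..1} \<Longrightarrow> \<phi> s * exp (- (of_real s)\<^sup>2 * \<kappa> / 2) = C"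
    using has_vector_derivative_zero_constant[OF convex_real_interval(5) const] by blast
  have "sb 0 = 0" "sb 1 = b" by (auto simp: sb_def vec_eq_iff)
  with C[of 0] C[of 1] have "integral\<^sup>L lborel (gexp A b) * exp (- \<kappa> / 2) = integral\<^sup>L lborel (gexp A 0)"
    by (simp add: \<phi>_def)
  then show ?thesis
    by (simp add: \<kappa>_def c_def exp_minus field_simps)
qed

section \<open>Determinant, trace and square roots along the segment from I to H\<close>

text \<open>Jacobi's formula at the identity, read off from the Leibniz expansion: a permutation
  other than \<open>id\<close> moves some k and also its image p k, so after one factor is
  differentiated another off-diagonal factor remains, and it vanishes at h = 0.\<close>

lemma det_I_plus_has_field_derivative:
  fixes Z :: "complex^'n^'n"
  shows "((\<lambda>h. det (\<chi> i j. (if i = j then 1 else 0) + h * Z $ i $ j)) has_field_derivative trace Z) (at 0)"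
proof -
  let ?f = "\<lambda>p i h. (if i = p i then 1 else 0) + h * Z $ i $ (p i)"
  let ?P = "{p. p permutes (UNIV :: 'n set)}"
  let ?d = "\<lambda>p. of_int (sign p) * (\<Sum>i\<in>UNIV. Z $ i $ (p i) * (\<Prod>j\<in>UNIV - {i}. ?f p j 0))"
  have "((\<lambda>h. \<Sum>p\<in>?P. of_int (sign p) * (\<Prod>i\<in>UNIV. ?f p i h)) has_field_derivative (\<Sum>p\<in>?P. ?d p)) (at 0)"
    by (intro DERIV_sum DERIV_cmult has_field_derivative_prod) (auto intro!: derivative_eq_intros)
  also have "(\<Sum>p\<in>?P. ?d p) = ?d id + (\<Sum>p\<in>?P - {id}. ?d p)"
    by (rule sum.remove) (auto simp: finite_permutations permutes_id)
  also have "?d id = trace Z" by (simp add: trace_def)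
  also have "(\<Sum>p\<in>?P - {id}. ?d p) = 0"
  proof (rule sum.neutral, intro ballI)
    fix p assume p: "p \<in> ?P - {id}"
    then obtain k where k: "p k \<noteq> k" by (metis Diff_iff eq_id_iff insertCI)
    have pk: "p (p k) \<noteq> p k"
      using p k by (metis Diff_iff mem_Collect_eq permutes_inj injD)
    have "(\<Prod>j\<in>UNIV - {i}. ?f p j 0) = 0" for i
    proof (cases "i = k")
      case True
      then have "p k \<in> UNIV - {i}" "?f p (p k) 0 = 0" using k pk by auto
      then show ?thesis by (intro prod_zero bexI[of _ "p k"]) (auto simp: True)
    next
      case False
      then have "k \<in> UNIV - {i}" "?f p k 0 = 0" using k by auto
      then show ?thesis by (intro prod_zero bexI[of _ k]) auto
    qed
    then show "?d p = 0" by (simp only: mult_zero_right sum.neutral_const)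
  qed
  finally show ?thesis by (simp add: det_def)
qed

text \<open>The parameter is complex although only the real segment matters: determinants and roots
  can then be differentiated as holomorphic functions.\<close>

definition homotopy_I :: "complex^'n^'n \<Rightarrow> complex \<Rightarrow> complex^'n^'n"
  where "homotopy_I H z = (\<chi> i j. (1 - z) * (if i = j then 1 else 0) + z * H $ i $ j)"

lemma has_field_derivative_prod_mset_linear:
  fixes t :: complex
  assumes "\<And>z. z \<in># M \<Longrightarrow> 1 - t + t * z \<noteq> 0"
  shows "((\<lambda>t. \<Prod>z\<in>#M. 1 - t + t * z) has_field_derivative
    (\<Sum>z\<in>#M. (z - 1) / (1 - t + t * z)) * (\<Prod>z\<in>#M. 1 - t + t * z)) (at t)"
  using assms
proof (induction M)
  case (add x M)
  let ?y = "1 - t + t * x"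
  have y: "?y \<noteq> 0" using add.prems[of x] by simp
  have x: "((\<lambda>t. 1 - t + t * x) has_field_derivative x - 1) (at t)"
    by (auto intro!: derivative_eq_intros)
  have M: "((\<lambda>t. \<Prod>z\<in>#M. 1 - t + t * z) has_field_derivative
    (\<Sum>z\<in>#M. (z - 1) / (1 - t + t * z)) * (\<Prod>z\<in>#M. 1 - t + t * z)) (at t)"
    using add by auto
  have gen: "y * (S * P) + (x - 1) * P = ((x - 1) / y + S) * (y * P)" if "y \<noteq> 0" for y S P
    using that by (simp add: field_simps)
  from DERIV_mult'[OF x M] show ?case
    unfolding gen[OF y] by (simp only: image_mset_add_mset prod_mset.add_mset sum_mset.add_mset)
qed simp

text \<open>Each factor has half the logarithmic derivative of its radicand; the positive real part
  keeps the radicand off the branch cut.\<close>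

lemma has_field_derivative_prod_mset_csqrt:
  assumes "\<And>z. z \<in># M \<Longrightarrow> Re (1 - t + t * z) > 0"
  shows "((\<lambda>t. \<Prod>z\<in>#M. csqrt (1 - t + t * z)) has_field_derivative
    (\<Sum>z\<in>#M. (z - 1) / (1 - t + t * z)) / 2 * (\<Prod>z\<in>#M. csqrt (1 - t + t * z))) (at t)"
  using assms
proof (induction M)
  case (add x M)
  let ?y = "1 - t + t * x"
  have y: "Re ?y > 0" using add by auto
  then have y': "?y \<notin> \<real>\<^sub>\<le>\<^sub>0" by (auto simp: complex_nonpos_Reals_iff)
  have y0: "?y \<noteq> 0" using y by (metis less_irrefl zero_complex.simps(1))
  have "((\<lambda>t. 1 - t + t * x) has_field_derivative x - 1) (at t)"
    by (auto intro!: derivative_eq_intros)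
  from has_field_derivative_csqrt'[OF this y']
  have c: "((\<lambda>t. csqrt (1 - t + t * x)) has_field_derivative (x - 1) / (2 * csqrt ?y)) (at t)" .
  have "(x - 1) / (2 * r) = (x - 1) / y / 2 * r" if "r * r = y" "r \<noteq> 0" for r y
    using that by (auto simp: field_simps)
  from this[of "csqrt ?y" ?y]
  have "(x - 1) / (2 * csqrt ?y) = (x - 1) / ?y / 2 * csqrt ?y"
    using y0 power2_csqrt[of ?y] by (simp add: power2_eq_square del: csqrt.simps)
  with c have c: "((\<lambda>t. csqrt (1 - t + t * x)) has_field_derivative (x - 1) / ?y / 2 * csqrt ?y) (at t)"
    by simp
  have M: "((\<lambda>t. \<Prod>z\<in>#M. csqrt (1 - t + t * z)) has_field_derivative
    (\<Sum>z\<in>#M. (z - 1) / (1 - t + t * z)) / 2 * (\<Prod>z\<in>#M. csqrt (1 - t + t * z))) (at t)"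
    using add by auto
  from DERIV_mult'[OF c M] show ?case
    by (simp add: distrib_right distrib_left add_divide_distrib mult_ac add.commute del: csqrt.simps)
qed simp

lemma det_homotopy_I:
  fixes H :: "complex^'n^'n"
  shows "det (homotopy_I H t) = (\<Prod>z\<in>#proots (char_polynomial H). 1 - t + t * z)"
proof (cases "t = 0")
  case True
  have "homotopy_I H 0 = mat 1" by (simp add: homotopy_I_def mat_def vec_eq_iff)
  with True show ?thesis by simp
next
  case False
  \<comment> \<open>With this x the matrix is - t (x I - H), so its determinant is (- t)^n times the
    characteristic polynomial at x. Distributing the factors - t over the linear factors gives - t
    (x - z) = 1 - t + t z.\<close>
  define x where "x = - (1 - t) / t"
  let ?M = "proots (char_polynomial H)"
  have "homotopy_I H t = (\<chi> i j. (- t) * ((if i = j then x else 0) - H $ i $ j))"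
    using False by (simp add: homotopy_I_def vec_eq_iff x_def field_simps)
  then have "det (homotopy_I H t) = (- t) ^ CARD('n) * det (\<chi> i j. (if i = j then x else 0) - H $ i $ j)"
    by (simp add: det_def prod.distrib prod_uminus sum_distrib_left mult_ac power_minus[of t])
  also have "det (\<chi> i j. (if i = j then x else 0) - H $ i $ j) = poly (\<Prod>z\<in>#?M. [:- z, 1:]) x"
    unfolding char_polynomial_factors[symmetric] poly_char_polynomial ..
  also have "(- t) ^ size M * poly (\<Prod>z\<in>#M. [:- z, 1:]) x = (\<Prod>z\<in>#M. 1 - t + t * z)" for M
  proof (induction M)
    case (add z M)
    have e: "(- t) * (x - z) = 1 - t + t * z" using False by (simp add: x_def field_simps)
    have h: "(1 - t + t * z) * ((- t) ^ size M * poly (\<Prod>z\<in>#M. [:- z, 1:]) x)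
        = (- t) ^ Suc (size M) * ((x - z) * poly (\<Prod>z\<in>#M. [:- z, 1:]) x)"
      by (simp only: e[symmetric] power_Suc mult_ac)
    have p: "poly (\<Prod>z\<in>#add_mset z M. [:- z, 1:]) x = (x - z) * poly (\<Prod>z\<in>#M. [:- z, 1:]) x"
      by (simp add: algebra_simps)
    show ?case unfolding p size_add_mset h[symmetric] add.IH by simp
  qed simp
  from this[of ?M, unfolded size_proots_char_polynomial]
  have "(- t) ^ CARD('n) * poly (\<Prod>z\<in>#?M. [:- z, 1:]) x = (\<Prod>z\<in>#?M. 1 - t + t * z)" .
  finally show ?thesis .
qed

text \<open>The determinant along the segment is differentiated in two ways: by Jacobi's formula,
  after factoring out the matrix at t, and through the product over the eigenvalues. Uniqueness of
  the derivative equates the results, and the nonzero determinant cancels.\<close>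

lemma trace_inverse_homotopy_I:
  fixes H :: "complex^'n^'n"
  assumes nz: "\<And>z. z \<in># proots (char_polynomial H) \<Longrightarrow> 1 - t + t * z \<noteq> 0"
  shows "det (homotopy_I H t) \<noteq> 0"
    and "trace (matrix_inv (homotopy_I H t) ** (H - mat 1))
      = (\<Sum>z\<in>#proots (char_polynomial H). (z - 1) / (1 - t + t * z))"
proof -
  let ?A = "homotopy_I H t" and ?S = "\<Sum>z\<in>#proots (char_polynomial H). (z - 1) / (1 - t + t * z)"
  show det: "det ?A \<noteq> 0" unfolding det_homotopy_I using nz by auto
  let ?Z = "matrix_inv ?A ** (H - mat 1)"
  have AZ: "?A ** ?Z = H - mat 1"
    by (simp add: matrix_mul_assoc matrix_inv_nonzero_det(1)[OF det])
  have factor: "homotopy_I H s = ?A ** (\<chi> i j. (if i = j then 1 else 0) + (s - t) * ?Z $ i $ j)" for s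
  proof -
    have "(\<chi> i j. (if i = j then 1 else 0) + (s - t) * ?Z $ i $ j) = mat 1 + (\<chi> i j. (s - t) * ?Z $ i $ j)"
      by (simp add: vec_eq_iff mat_def)
    moreover have "?A ** (\<chi> i j. (s - t) * ?Z $ i $ j) = (\<chi> i j. (s - t) * (?A ** ?Z) $ i $ j)"
      by (simp add: vec_eq_iff matrix_matrix_mult_def sum_distrib_left mult_ac)
    ultimately show ?thesis
      unfolding AZ by (simp add: matrix_add_ldistrib) (simp add: vec_eq_iff homotopy_I_def mat_def algebra_simps)
  qed
  have eq: "det (homotopy_I H s) = det ?A * det (\<chi> i j. (if i = j then 1 else 0) + (s - t) * ?Z $ i $ j)" for s
    by (subst factor[of s]) (rule det_mul)
  have "((\<lambda>h. det (\<chi> i j. (if i = j then 1 else 0) + h * ?Z $ i $ j)) has_field_derivative trace ?Z) (at (t - t))"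
    using det_I_plus_has_field_derivative[of ?Z] by simp
  moreover have "((\<lambda>s. s - t) has_field_derivative 1) (at t)"
    by (auto intro!: derivative_eq_intros)
  ultimately have "((\<lambda>s. det (\<chi> i j. (if i = j then 1 else 0) + (s - t) * ?Z $ i $ j)) has_field_derivative trace ?Z * 1) (at t)"
    by (rule DERIV_chain2[where g = "\<lambda>s. s - t"])
  then have "((\<lambda>s. det (\<chi> i j. (if i = j then 1 else 0) + (s - t) * ?Z $ i $ j)) has_field_derivative trace ?Z) (at t)"
    by (simp only: mult_1_right)
  from DERIV_cmult[OF this, of "det ?A"]
  have "((\<lambda>s. det (homotopy_I H s)) has_field_derivative det ?A * trace ?Z) (at t)"
    unfolding eq[symmetric] .
  moreover have "((\<lambda>s. det (homotopy_I H s)) has_field_derivative ?S * det ?A) (at t)"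
    unfolding det_homotopy_I by (rule has_field_derivative_prod_mset_linear[OF nz])
  ultimately have "det ?A * trace ?Z = ?S * det ?A" by (rule DERIV_unique)
  then show "trace ?Z = ?S" using det by simp
qed

lemma quad_homotopy_I:
  "quad (homotopy_I H z) u = (1 - z) * of_real ((norm u)\<^sup>2) + z * quad H u"
proof -
  have "(norm u)\<^sup>2 = (\<Sum>i\<in>UNIV. (u $ i)\<^sup>2)"
    unfolding power2_norm_eq_inner by (simp add: inner_vec_def power2_eq_square)
  then have n: "(1 - z) * of_real ((norm u)\<^sup>2) = (\<Sum>i\<in>UNIV. \<Sum>j\<in>UNIV. if i = j then (1 - z) * of_real (u $ i * u $ j) else 0)"
    by (simp add: sum_distrib_left power2_eq_square)
  show ?thesis
    unfolding n unfolding quad_def homotopy_I_def sum_distrib_left sum.distrib[symmetric]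
    by (intro sum.cong refl) (auto simp: algebra_simps)
qed

text \<open>With T the trace of H_t^{-1} (H - I), the Gaussian integral satisfies G' = - T G / 2 and
  the product of roots s' = T s / 2, whence (G s)' = 0. At t = 0 the product G s is the classical
  Gaussian integral, since s = 1 there.\<close>

lemma gexp_integral_0:
  fixes H :: "complex^'n^'n"
  assumes sym: "transpose H = H" and pd: "pos_definite (Re_matrix H)"
    and eps: "\<epsilon> > 0" and co: "\<And>u. \<epsilon> * (norm u)\<^sup>2 \<le> Re (quad H u)"
  shows "integral\<^sup>L lborel (gexp H 0) * sqrt_det H = of_real ((2 * pi) powr (real CARD('n) / 2))"
proof -
  let ?M = "proots (char_polynomial H)"
  define Ht where "Ht = (\<lambda>t::real. homotopy_I H (of_real t))"
  define K where "K = H - mat 1"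
  \<comment> \<open>A coercivity constant common to I and H, hence valid along the whole segment by
    convexity.\<close>
  define \<delta> where "\<delta> = min 1 \<epsilon>"
  have \<delta>: "\<delta> > 0" "\<delta> \<le> 1" "\<delta> \<le> \<epsilon>" using eps by (auto simp: \<delta>_def)
  have symH: "H $ i $ j = H $ j $ i" for i j
    using arg_cong[OF sym, of "\<lambda>A. A $ j $ i"] by (simp add: transpose_def)
  have symt: "Ht t $ i $ j = Ht t $ j $ i" for i j t
    using symH[of i j] by (simp add: Ht_def homotopy_I_def)
  have quad_t: "quad (Ht t) u = of_real ((norm u)\<^sup>2) + of_real t * quad K u" for t u
  proof -
    have K: "quad K u = quad H u - of_real ((norm u)\<^sup>2)"
      using quad_homotopy_I[of H 0 u] unfolding K_def quad_def homotopy_I_def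
      by (simp add: mat_def left_diff_distrib sum_subtractf)
    show ?thesis unfolding Ht_def quad_homotopy_I K by (simp add: algebra_simps)
  qed
  have co_t: "\<delta> * (norm u)\<^sup>2 \<le> Re (quad (Ht t) u)" if t: "t \<in> {0..1}" for t u
  proof -
    have "\<delta> * (norm u)\<^sup>2 = (1 - t) * (\<delta> * (norm u)\<^sup>2) + t * (\<delta> * (norm u)\<^sup>2)" by (simp add: algebra_simps)
    also have "\<dots> \<le> (1 - t) * (norm u)\<^sup>2 + t * Re (quad H u)"
    proof (intro add_mono mult_left_mono)
      show "\<delta> * (norm u)\<^sup>2 \<le> Re (quad H u)"
        using order_trans[OF mult_right_mono[OF \<delta>(3)] co] by simp
      show "\<delta> * (norm u)\<^sup>2 \<le> (norm u)\<^sup>2" using \<delta> by (simp add: mult_left_le_one_le)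
    qed (use t in auto)
    also have "\<dots> = Re (quad (Ht t) u)"
      unfolding Ht_def quad_homotopy_I by simp
    finally show ?thesis .
  qed
  have Re_pos: "Re (1 - of_real t + of_real t * z) > 0" if t: "t \<in> {0..1}" and z: "z \<in># ?M" for t z
  proof -
    have "Re z > 0" by (rule Re_eigenvalue_pos[OF sym pd z])
    then have "0 < (1 - t) + t * Re z"
      using t by (cases "t = 0") (auto intro: add_nonneg_pos)
    then show ?thesis by simp
  qed
  have nz: "1 - of_real t + of_real t * z \<noteq> 0" if "t \<in> {0..1}" "z \<in># ?M" for t z
    using Re_pos[OF that] by (metis less_irrefl zero_complex.simps(1))
  define G where "G = (\<lambda>t. integral\<^sup>L lborel (gexp (Ht t) 0))"
  define s where "s = (\<lambda>t::complex. \<Prod>z\<in>#?M. csqrt (1 - t + t * z))"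
  define T where "T = (\<lambda>t::real. trace (matrix_inv (Ht t) ** K))"
  have s_der: "(s has_field_derivative T t / 2 * s (of_real t)) (at (of_real t))" if t: "t \<in> {0..1}" for t
  proof -
    have "T t = (\<Sum>z\<in>#?M. (z - 1) / (1 - of_real t + of_real t * z))"
      unfolding T_def Ht_def K_def by (rule trace_inverse_homotopy_I(2)) (rule nz[OF t])
    then show ?thesis
      unfolding s_def using has_field_derivative_prod_mset_csqrt[of ?M "of_real t", OF Re_pos[OF t]] by simp
  qed
  have quad_K: "quad K u * g = (\<Sum>i\<in>UNIV. \<Sum>j\<in>UNIV. K $ i $ j * (of_real (u $ j * u $ i) * g))"
    for u and g :: complex
    unfolding quad_def sum_distrib_right by (intro sum.cong refl) (simp add: mult_ac)
  have mom_quad: "integral\<^sup>L lborel (\<lambda>u. - (1/2) * quad K u * gexp (Ht t) 0 u) = - (1/2) * T t * G t"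
    if t: "t \<in> {0..1}" for t
  proof -
    note mom = gexp_moments[OF symt \<delta>(1) co_t[OF t]]
    have det: "det (Ht t) \<noteq> 0"
      unfolding Ht_def by (rule trace_inverse_homotopy_I(1)) (rule nz[OF t])
    \<comment> \<open>The second moments form the matrix G times the inverse of H_t, so the integral
      of \<open>quad K\<close> against the Gaussian becomes a trace.\<close>
    define Mm where "Mm = (\<chi> k j. integral\<^sup>L lborel (\<lambda>u. of_real (u $ k * u $ j) * gexp (Ht t) 0 u))"
    have HM: "Ht t ** Mm = (\<chi> i j. if i = j then G t else 0)"
      using mom(5) by (simp add: vec_eq_iff matrix_matrix_mult_def Mm_def G_def)
    have "Mm = matrix_inv (Ht t) ** (Ht t ** Mm)"
      by (simp add: matrix_mul_assoc matrix_inv_nonzero_det(2)[OF det])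
    also have "\<dots> = (\<chi> i j. matrix_inv (Ht t) $ i $ j * G t)"
      unfolding HM by (simp add: vec_eq_iff matrix_matrix_mult_def if_distrib cong: if_cong)
    finally have Mm: "Mm $ i $ j = matrix_inv (Ht t) $ i $ j * G t" for i j by simp
    have "integral\<^sup>L lborel (\<lambda>u. quad K u * gexp (Ht t) 0 u) = (\<Sum>i\<in>UNIV. \<Sum>j\<in>UNIV. K $ i $ j * Mm $ j $ i)"
      unfolding quad_K Mm_def
      by (simp add: Bochner_Integration.integral_sum Bochner_Integration.integrable_sum mom(3)[simplified])
    also have "\<dots> = trace (K ** matrix_inv (Ht t)) * G t"
      unfolding Mm trace_def matrix_matrix_mult_def by (simp add: sum_distrib_right mult.assoc)
    also have "\<dots> = T t * G t" unfolding T_def by (subst trace_mul_sym) simp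
    finally show ?thesis by (simp add: mult.assoc)
  qed
  have G_der: "(G has_vector_derivative - (1/2) * T t * G t) (at t within {0..1})" if t: "t \<in> {0..1}" for t
  proof -
    let ?L = "\<Sum>i\<in>UNIV. \<Sum>j\<in>UNIV. norm (K $ i $ j)"
    have L: "?L \<ge> 0" by (simp add: sum_nonneg)
    \<comment> \<open>The constant of \<open>gexp_bound\<close> for k = 2, the growth of
      \<open>quad K\<close>, and linear rate 0.\<close>
    let ?B = "\<lambda>u::real^'n. (?L * exp (real 2 ^ 2 / \<delta>)) * exp (- (\<delta> / 4) * (norm u)\<^sup>2)"
    have "(G has_vector_derivative integral\<^sup>L lborel (\<lambda>u. - (1/2) * quad K u * gexp (Ht t) 0 u)) (at t within {0..1})"
      unfolding G_def
    proof (rule has_vector_derivative_lebesgue_integral[where F' = "\<lambda>t u. - (1/2) * quad K u * gexp (Ht t) 0 u" and B = ?B])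
      show "integrable lborel (gexp (Ht t) 0)" if "t \<in> {0..1}" for t
        by (rule gexp_moments[OF symt \<delta>(1) co_t[OF that]])
      show "integrable lborel ?B" using \<delta> by (intro integrable_gaussian) auto
      show "((\<lambda>t. gexp (Ht t) 0 u) has_vector_derivative - (1/2) * quad K u * gexp (Ht t) 0 u) (at t within {0..1})" for t u
      proof -
        have "((\<lambda>z. exp (lin 0 u - (of_real ((norm u)\<^sup>2) + z * quad K u) / 2)) has_field_derivative
            - (1/2) * quad K u * gexp (Ht t) 0 u) (at (of_real t))"
          unfolding gexp_def quad_t by (rule derivative_eq_intros refl | simp)+
        from has_vector_derivative_real_field[OF this] show ?thesis
          by (simp add: gexp_def quad_t)
      qed
      show "norm (- (1/2) * quad K u * gexp (Ht t) 0 u) \<le> ?B u" if t: "t \<in> {0..1}" for t u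
      proof -
        have "norm (- (1/2) * quad K u * gexp (Ht t) 0 u) \<le> norm (quad K u) * norm (gexp (Ht t) 0 u)"
          by (simp add: norm_mult)
        also have "\<dots> \<le> (?L * (1 + norm u)\<^sup>2) * norm (gexp (Ht t) 0 u)"
          using norm_quad_le[of K u] mult_left_mono[OF power_mono[of "norm u" "1 + norm u" 2] L]
          by (intro mult_right_mono) auto
        also have "\<dots> = ?L * ((1 + norm u)\<^sup>2 * norm (gexp (Ht t) 0 u))" by simp
        also have "\<dots> \<le> ?L * (exp ((real 2 + 0)\<^sup>2 / \<delta>) * exp (- (\<delta> / 4) * (norm u)\<^sup>2))"
          by (intro mult_left_mono L gexp_bound \<delta>(1) co_t t) (simp add: lin_def)
        finally show ?thesis by (simp only: mult.assoc add_0_right)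
      qed
    qed (use t in auto)
    then show ?thesis unfolding mom_quad[OF t] .
  qed
  have const: "((\<lambda>t. G t * s (of_real t)) has_vector_derivative 0) (at t within {0..1})" if t: "t \<in> {0..1}" for t
    using has_vector_derivative_mult[OF G_der[OF t] has_vector_derivative_real_field[OF s_der[OF t]]]
    by (simp add: algebra_simps)
  obtain C where C: "\<And>t. t \<in> {0..1} \<Longrightarrow> G t * s (of_real t) = C"
    using has_vector_derivative_zero_constant[OF convex_real_interval(5) const] by blast
  have "Ht 1 = H" by (simp add: Ht_def homotopy_I_def vec_eq_iff)
  moreover have "s 1 = sqrt_det H" by (simp add: s_def sqrt_det_def)
  moreover have "s 0 = 1" by (simp add: s_def)
  moreover have "G 0 = of_real ((2 * pi) powr (real CARD('n) / 2))"
  proof -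
    have "gexp (Ht 0) 0 = (\<lambda>u. of_real (exp (- (1 / 2) * (norm u)\<^sup>2)))"
      unfolding gexp_def quad_t by (simp add: lin_def exp_of_real[symmetric])
    then show ?thesis
      unfolding G_def
      using has_bochner_integral_gaussian_euclidean[of 1, where 'a = "real^'n"]
      by (simp add: has_bochner_integral_iff)
  qed
  ultimately show ?thesis using C[of 0] C[of 1] by (simp add: G_def)
qed

text \<open>The form has a positive minimum on the compact unit sphere, and homogeneity of degree 2
  extends the bound to all vectors.\<close>

lemma pos_definite_coercive:
  fixes H :: "complex^'n^'n"
  assumes "pos_definite (Re_matrix H)"
  obtains \<epsilon> where "\<epsilon> > 0" "\<And>u. \<epsilon> * (norm u)\<^sup>2 \<le> Re (quad H u)"
proof -
  have Re_quad: "Re (quad H u) = u \<bullet> (Re_matrix H *v u)" for u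
    unfolding quad_def by (simp add: inner_vec_def matrix_vector_mult_def Re_matrix_def sum_distrib_left mult_ac)
  obtain v :: "real^'n" where v: "norm v = 1" 
     "\<And>u. norm u = 1 \<Longrightarrow> Re (quad H v) \<le> Re (quad H u)"
  proof -
    have "compact (sphere (0::real^'n) 1)" by simp
    moreover have "sphere (0::real^'n) 1 \<noteq> {}" by simp
    moreover have "continuous_on (sphere (0::real^'n) 1) (\<lambda>u. Re (quad H u))"
      by (intro continuous_intros)
    ultimately obtain v where "v \<in> sphere (0::real^'n) 1" "\<forall>u\<in>sphere (0::real^'n) 1. Re (quad H v) \<le> Re (quad H u)"
      using continuous_attains_inf by blast
    then show ?thesis using that by auto
  qed
  have "v \<noteq> 0" using v by auto
  then have "Re (quad H v) > 0" using assms unfolding Re_quad pos_definite_def by auto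
  moreover have "Re (quad H v) * (norm u)\<^sup>2 \<le> Re (quad H u)" for u
  proof (cases "u = 0")
    case False
    have "Re (quad H v) \<le> Re (quad H (u /\<^sub>R norm u))" using False by (intro v) auto
    also have "Re (quad H (u /\<^sub>R norm u)) = Re (quad H u) / (norm u)\<^sup>2"
      unfolding Re_quad by (simp add: scaleR_matrix_vector_assoc[symmetric] matrix_vector_mult_scaleR power2_eq_square divide_inverse mult_ac)
    finally show ?thesis using False by (simp add: pos_le_divide_eq)
  qed (simp add: quad_def)
  ultimately show ?thesis using that by blast
qed

lemma gexp_integral:
  fixes H :: "complex^'n^'n"
  assumes sym: "transpose H = H" and pd: "pos_definite (Re_matrix H)"
  shows "sqrt_det H \<noteq> 0"
    and "integral\<^sup>L lborel (gexp H b) = of_real ((2 * pi) powr (real CARD('n) / 2)) / sqrt_det H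
      * exp (1 / 2 * bilin_dot b (matrix_inv H *v b))"
proof -
  obtain \<epsilon> where eps: "\<epsilon> > 0" and co: "\<And>u. \<epsilon> * (norm u)\<^sup>2 \<le> Re (quad H u)"
    using pos_definite_coercive[OF pd] by blast
  note 0 = gexp_integral_0[OF sym pd eps co]
  \<comment> \<open>The product in the previous fact is a positive real, so neither factor vanishes;
    squaring then gives a nonzero \<open>det H\<close>.\<close>
  then show nz: "sqrt_det H \<noteq> 0" by auto
  have det: "det H \<noteq> 0" using nz by (metis sqrt_det_power2 power_eq_0_iff)
  have symH: "H $ i $ j = H $ j $ i" for i j
    using arg_cong[OF sym, of "\<lambda>A. A $ j $ i"] by (simp add: transpose_def)
  show "integral\<^sup>L lborel (gexp H b) = of_real ((2 * pi) powr (real CARD('n) / 2)) / sqrt_det H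
      * exp (1 / 2 * bilin_dot b (matrix_inv H *v b))"
    unfolding gexp_integral_shift[OF symH eps co det, of b] 0[symmetric] using nz by simp
qed

section \<open>Taylor bounds and symmetry of the Hessian\<close>

lemma bounded_linear_lin: "bounded_linear (lin b)"
  unfolding linear_conv_bounded_linear[symmetric]
  by (rule linearI)
     (simp_all add: lin_def algebra_simps sum.distrib sum_distrib_left scaleR_conv_of_real[where 'a = complex])

lemma lin_axis [simp]: "lin b (axis i 1) = b $ i"
  using lin_add_axis[of b 0 1 i] by (simp add: lin_def)

lemma lin_scaleR [simp]: "lin b (t *\<^sub>R u) = of_real t * lin b u"
  by (simp add: lin_def sum_distrib_left algebra_simps)

lemma lin_diff_vec: "lin (a - b) u = lin a u - lin b u"
  by (simp add: lin_def algebra_simps sum_subtractf)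

lemma quad_has_derivative:
  assumes sym: "\<And>i j. A $ i $ j = A $ j $ i"
  shows "(quad A has_derivative lin (\<chi> i. 2 * lin (A $ i) u)) (at u)"
proof -
  note bl = bounded_linear_lin[THEN bounded_linear.has_derivative, OF has_derivative_ident]
  have q: "quad A = (\<lambda>u. \<Sum>i\<in>UNIV. of_real (u $ i) * lin (A $ i) u)"
    unfolding fun_eq_iff quad_def lin_def sum_distrib_left by (intro allI sum.cong) (auto simp: algebra_simps)
  have comp: "((\<lambda>u. complex_of_real (u $ i)) has_derivative (\<lambda>v. of_real (v $ i))) (at u)" for i
    by (intro bounded_linear.has_derivative[OF bounded_linear_of_real]
        bounded_linear.has_derivative[OF bounded_linear_vec_nth] has_derivative_ident)
  have "(quad A has_derivative (\<lambda>v. \<Sum>i\<in>UNIV. of_real (u $ i) * lin (A $ i) v + of_real (v $ i) * lin (A $ i) u)) (at u)"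
    unfolding q by (intro has_derivative_sum has_derivative_mult comp bl)
  moreover have "(\<Sum>i\<in>UNIV. of_real (u $ i) * lin (A $ i) v + of_real (v $ i) * lin (A $ i) u)
      = lin (\<chi> i. 2 * lin (A $ i) u) v" for v
  proof -
    have "(\<Sum>i\<in>UNIV. of_real (u $ i) * lin (A $ i) v) = (\<Sum>i\<in>UNIV. of_real (v $ i) * lin (A $ i) u)"
      unfolding lin_def sum_distrib_left
      by (subst sum.swap) (intro sum.cong refl, simp add: sym mult_ac)
    then show ?thesis by (simp add: sum.distrib lin_def[of "\<chi> i. 2 * lin (A $ i) u"] sum_distrib_left mult_ac)
  qed
  ultimately show ?thesis by simp
qed

lemma Ck_on_continuous_on: "Ck_on k f D \<Longrightarrow> continuous_on D f"
  by (cases k) (auto intro: differentiable_imp_continuous_on)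

lemma Ck_on_has_derivative:
  fixes f :: "real^'n \<Rightarrow> complex"
  assumes "Ck_on (Suc k) f D" "open D" "w \<in> D"
  shows "(f has_derivative lin (gradient f w)) (at w)"
proof -
  have "f differentiable (at w)"
    using assms by (simp add: differentiable_on_eq_differentiable_at)
  then have fd: "(f has_derivative frechet_derivative f (at w)) (at w)"
    by (simp add: frechet_derivative_works)
  then interpret bounded_linear "frechet_derivative f (at w)" by (rule has_derivative_bounded_linear)
  have "frechet_derivative f (at w) = lin (gradient f w)"
  proof (rule ext)
    fix v :: "real^'n"
    have "frechet_derivative f (at w) v = frechet_derivative f (at w) (\<Sum>i\<in>UNIV. v $ i *\<^sub>R axis i 1)"
      by (simp add: basis_expansion[of v, unfolded scalar_mult_eq_scaleR])
    then show "frechet_derivative f (at w) v = lin (gradient f w) v"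
      by (simp add: sum scaleR lin_def gradient_def partial_deriv_def scaleR_conv_of_real[where 'a = complex] mult.commute)
  qed
  with fd show ?thesis by simp
qed

text \<open>The mean value inequality is used on the ball of radius |w - w0| instead of r: there the
  gradient is bounded by C |w - w0|^k, so the order of vanishing rises by one.\<close>

lemma increment_bound:
  fixes h :: "real^'n \<Rightarrow> complex"
  assumes der: "\<And>w. w \<in> cball w0 r \<Longrightarrow> (h has_derivative lin (p w)) (at w)"
    and bd: "\<And>w i. w \<in> cball w0 r \<Longrightarrow> norm (p w $ i) \<le> C * norm (w - w0) ^ k"
    and C: "C \<ge> 0" and w: "w \<in> cball w0 r"
  shows "norm (h w - h w0) \<le> real CARD('n) * C * norm (w - w0) ^ Suc k"
proof -
  define \<rho> where "\<rho> = norm (w - w0)"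
  have \<rho>: "\<rho> \<ge> 0" "\<rho> \<le> r" using w by (auto simp: \<rho>_def dist_norm norm_minus_commute)
  have sub: "cball w0 \<rho> \<subseteq> cball w0 r" using \<rho> by auto
  have "norm (h w - h w0) \<le> (real CARD('n) * C * \<rho> ^ k) * norm (w - w0)"
  proof (rule differentiable_bound[OF convex_cball])
    fix z assume z: "z \<in> cball w0 \<rho>"
    have "z \<in> cball w0 r" using z sub by blast
    then show "(h has_derivative lin (p z)) (at z within cball w0 \<rho>)"
      by (rule has_derivative_at_withinI[OF der])
    show "onorm (lin (p z)) \<le> real CARD('n) * C * \<rho> ^ k"
    proof (rule onorm_le)
      fix v :: "real^'n"
      have "norm (p z $ i) \<le> C * \<rho> ^ k" for i
      proof -
        have "norm (p z $ i) \<le> C * norm (z - w0) ^ k" using bd z sub by auto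
        also have "\<dots> \<le> C * \<rho> ^ k"
          using z C by (intro mult_left_mono power_mono) (auto simp: dist_norm norm_minus_commute)
        finally show ?thesis .
      qed
      then have "(\<Sum>i\<in>UNIV. norm (p z $ i)) \<le> (\<Sum>i\<in>(UNIV::'n set). C * \<rho> ^ k)"
        by (intro sum_mono)
      then have "(\<Sum>i\<in>UNIV. norm (p z $ i)) \<le> real CARD('n) * C * \<rho> ^ k" by simp
      then show "norm (lin (p z) v) \<le> real CARD('n) * C * \<rho> ^ k * norm v"
        by (intro order_trans[OF norm_lin_le] mult_right_mono) auto
    qed
  qed (use \<rho> in \<open>auto simp: \<rho>_def dist_norm norm_minus_commute\<close>)
  then show ?thesis by (simp add: \<rho>_def mult_ac)
qed

lemma C1_bound:
  fixes f :: "real^'n \<Rightarrow> complex"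
  assumes f: "Ck_on (Suc k) f D" and D: "open D" "cball w0 r \<subseteq> D"
  obtains C where "C \<ge> 0" "\<And>w. w \<in> cball w0 r \<Longrightarrow> norm (f w - f w0) \<le> C * norm (w - w0)"
proof -
  have "\<exists>B. \<forall>w\<in>cball w0 r. norm (partial_deriv i f w) \<le> B" for i
  proof -
    have "continuous_on (cball w0 r) (partial_deriv i f)"
      using f D by (auto intro: continuous_on_subset[OF Ck_on_continuous_on])
    then have "bounded (partial_deriv i f ` cball w0 r)"
      by (intro compact_imp_bounded compact_continuous_image) auto
    then show ?thesis by (auto simp: bounded_iff)
  qed
  then obtain B where B: "\<And>i w. w \<in> cball w0 r \<Longrightarrow> norm (partial_deriv i f w) \<le> B i" by metis
  define C where "C = (\<Sum>i\<in>UNIV. \<bar>B i\<bar>)"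
  have C: "C \<ge> 0" by (simp add: C_def sum_nonneg)
  have BC: "norm (gradient f w $ i) \<le> C" if "w \<in> cball w0 r" for w i
  proof -
    have "norm (gradient f w $ i) \<le> \<bar>B i\<bar>" using B[OF that, of i] by (simp add: gradient_def)
    also have "\<dots> \<le> C" unfolding C_def by (rule member_le_sum) auto
    finally show ?thesis .
  qed
  have "norm (f w - f w0) \<le> real CARD('n) * C * norm (w - w0) ^ Suc 0" if "w \<in> cball w0 r" for w
    by (rule increment_bound[where p = "gradient f", OF _ _ C that])
       (use BC D Ck_on_has_derivative[OF f] in auto)
  then show ?thesis using C by (intro that[of "real CARD('n) * C"]) auto
qed

text \<open>The Taylor remainder has gradient \<open>gradient f w - gradient f w0\<close>, which
  \<open>C1_bound\<close> controls for each partial derivative; \<open>increment_bound\<close>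
  raises the order from 1 to 2.\<close>

lemma C2_bound:
  fixes f :: "real^'n \<Rightarrow> complex"
  assumes f: "Ck_on (Suc (Suc k)) f D" and D: "open D" "cball w0 r \<subseteq> D"
  obtains C where "C \<ge> 0" "\<And>w. w \<in> cball w0 r \<Longrightarrow>
    norm (f w - f w0 - lin (gradient f w0) (w - w0)) \<le> C * norm (w - w0) ^ 2"
proof -
  have "\<exists>B\<ge>0. \<forall>w\<in>cball w0 r. norm (partial_deriv i f w - partial_deriv i f w0) \<le> B * norm (w - w0)" for i
  proof -
    have "Ck_on (Suc k) (partial_deriv i f) D" using f by (simp only: Ck_on.simps(2)[of "Suc k"])
    from C1_bound[OF this D] show ?thesis by metis
  qed
  then obtain B where B: "\<And>i. B i \<ge> 0"
      "\<And>i w. w \<in> cball w0 r \<Longrightarrow> norm (partial_deriv i f w - partial_deriv i f w0) \<le> B i * norm (w - w0)" by metis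
  define C where "C = (\<Sum>i\<in>UNIV. B i)"
  have C: "C \<ge> 0" using B by (simp add: C_def sum_nonneg)
  have BC: "norm ((gradient f w - gradient f w0) $ i) \<le> C * norm (w - w0) ^ 1" if "w \<in> cball w0 r" for w i
  proof -
    have "norm ((gradient f w - gradient f w0) $ i) \<le> B i * norm (w - w0)"
      using B(2)[OF that, of i] by (simp add: gradient_def)
    also have "\<dots> \<le> C * norm (w - w0)" unfolding C_def
      by (intro mult_right_mono member_le_sum) (auto simp: B)
    finally show ?thesis by simp
  qed
  let ?h = "\<lambda>w. f w - lin (gradient f w0) (w - w0)"
  have der: "(?h has_derivative lin (gradient f w - gradient f w0)) (at w)" if "w \<in> cball w0 r" for w
  proof -
    have "(?h has_derivative (\<lambda>v. lin (gradient f w) v - lin (gradient f w0) (v - 0))) (at w)"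
      using Ck_on_has_derivative[OF f D(1), of w] that D(2)
      by (intro has_derivative_diff bounded_linear.has_derivative[OF bounded_linear_lin]
           has_derivative_ident has_derivative_const) auto
    then show ?thesis by (simp add: lin_diff_vec[abs_def])
  qed
  have "norm (?h w - ?h w0) \<le> real CARD('n) * C * norm (w - w0) ^ Suc 1" if "w \<in> cball w0 r" for w
    by (rule increment_bound[OF der BC C that])
  then have "norm (f w - f w0 - lin (gradient f w0) (w - w0)) \<le> (real CARD('n) * C) * norm (w - w0) ^ 2"
    if "w \<in> cball w0 r" for w
    using that by (simp add: lin_def algebra_simps numeral_2_eq_2)
  then show ?thesis using C by (intro that[of "real CARD('n) * C"]) auto
qed

text \<open>For \<open>g\<close> the gradient of \<open>f\<close> and \<open>a\<close> that of its
  i-th partial derivative, the second difference is h^2 times a mixed derivative up to O(h^3). The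
  mean value inequality is applied in direction i to the difference of \<open>f\<close> along two
  parallel segments a distance h apart, minus its expected linear part.\<close>

lemma second_difference_bound:
  fixes f :: "real^'n \<Rightarrow> complex"
  assumes der: "\<And>w. w \<in> cball w0 r \<Longrightarrow> (f has_derivative lin (g w)) (at w)"
    and tay: "\<And>w. w \<in> cball w0 r \<Longrightarrow> norm (g w $ i - g w0 $ i - lin a (w - w0)) \<le> C * norm (w - w0) ^ 2"
    and C: "C \<ge> 0" and h: "0 < h" "2 * h \<le> r"
  shows "norm (f (w0 + h *\<^sub>R axis i 1 + h *\<^sub>R axis j 1) - f (w0 + h *\<^sub>R axis i 1)
      - f (w0 + h *\<^sub>R axis j 1) + f w0 - of_real (h\<^sup>2) * a $ j) \<le> 8 * C * h ^ 3"
proof -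
  let ?P = "\<lambda>s. w0 + h *\<^sub>R axis j 1 + s *\<^sub>R axis i 1" and ?Q = "\<lambda>s. w0 + s *\<^sub>R axis i 1"
  have nP: "norm (?P s - w0) \<le> 2 * h" "norm (?Q s - w0) \<le> 2 * h" if "s \<in> {0..h}" for s
    using that h norm_triangle_ineq[of "h *\<^sub>R axis j (1::real)" "s *\<^sub>R axis i 1"] by auto
  have inP: "?P s \<in> cball w0 r" "?Q s \<in> cball w0 r" if "s \<in> {0..h}" for s
    unfolding mem_cball dist_norm norm_minus_commute[of w0] using nP[OF that] h by auto
  have vd: "((\<lambda>s. f (c + s *\<^sub>R axis i 1)) has_derivative (\<lambda>t. t *\<^sub>R g (c + s *\<^sub>R axis i 1) $ i)) (at s within {0..h})"
    if "c + s *\<^sub>R axis i 1 \<in> cball w0 r" for c s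
  proof -
    have "((\<lambda>s. c + s *\<^sub>R axis i 1) has_derivative (\<lambda>t. t *\<^sub>R axis i 1)) (at s within {0..h})"
      by (auto intro!: derivative_eq_intros)
    from has_derivative_compose[OF this der[OF that]]
    show ?thesis
      by (simp add: scaleR_conv_of_real[where 'a = complex])
  qed
  let ?\<phi> = "\<lambda>s. f (?P s) - f (?Q s) - s *\<^sub>R (of_real h * a $ j)"
  let ?d = "\<lambda>s. g (?P s) $ i - g (?Q s) $ i - of_real h * a $ j"
  have "norm (?\<phi> h - ?\<phi> 0) \<le> (8 * C * h\<^sup>2) * norm (h - 0)"
  proof (rule differentiable_bound[where f' = "\<lambda>s t. t *\<^sub>R ?d s"])
    fix s assume s: "s \<in> {0..h}"
    show "(?\<phi> has_derivative (\<lambda>t. t *\<^sub>R ?d s)) (at s within {0..h})"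
    proof -
      have "(?\<phi> has_derivative (\<lambda>t. t *\<^sub>R g (?P s) $ i - t *\<^sub>R g (?Q s) $ i - t *\<^sub>R (of_real h * a $ j))) (at s within {0..h})"
        by (intro has_derivative_diff vd inP s bounded_linear.has_derivative[OF bounded_linear_scaleR_left] has_derivative_ident)
      then show ?thesis by (simp add: scaleR_diff_right)
    qed
    have e: "of_real h * a $ j = lin a (?P s - w0) - lin a (?Q s - w0)"
    proof -
      have "lin a (?P s - w0) = lin a (?Q s - w0) + of_real h * a $ j"
        using lin_add_axis[of a "?Q s - w0" h j] by (simp add: algebra_simps)
      then show ?thesis by simp
    qed
    have eq: "?d s = (g (?P s) $ i - g w0 $ i - lin a (?P s - w0)) - (g (?Q s) $ i - g w0 $ i - lin a (?Q s - w0))"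
      unfolding e by simp
    have "norm (?d s) \<le> C * norm (?P s - w0) ^ 2 + C * norm (?Q s - w0) ^ 2"
      unfolding eq by (rule order_trans[OF norm_triangle_ineq4]) (intro add_mono tay inP s)
    \<comment> \<open>Both points lie within 2 h of \<open>w0\<close>, whence 2 C (2 h)^2 = 8 C h^2;
      the length h of the segment gives the third power.\<close>
    also have "\<dots> \<le> C * (2 * h)\<^sup>2 + C * (2 * h)\<^sup>2"
      using C nP[OF s] by (intro add_mono mult_left_mono power_mono) auto
    also have "\<dots> = 8 * C * h\<^sup>2" by (simp add: power2_eq_square)
    finally have b: "norm (?d s) \<le> 8 * C * h\<^sup>2" .
    show "onorm (\<lambda>t. t *\<^sub>R ?d s) \<le> 8 * C * h\<^sup>2"
      by (rule onorm_le) (use mult_left_mono[OF b abs_ge_zero] in \<open>simp add: mult.commute[of "8 * C * h\<^sup>2"]\<close>)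
  qed (use h in auto)
  then show ?thesis
    using h by (simp add: scaleR_conv_of_real[where 'a = complex] power2_eq_square power3_eq_cube algebra_simps)
qed

text \<open>The second difference is unchanged when i and j are exchanged, so h^2 times either mixed
  derivative approximates it up to O(h^3). Dividing by h^2 and letting h tend to 0 identifies the
  two.\<close>

lemma mixed_partial_deriv_commute:
  fixes f :: "real^'n \<Rightarrow> complex"
  assumes f: "Ck_on (Suc (Suc (Suc k))) f D" and D: "open D" and w0: "w0 \<in> D"
  shows "partial_deriv i (partial_deriv j f) w0 = partial_deriv j (partial_deriv i f) w0"
proof -
  obtain r where r: "r > 0" "cball w0 r \<subseteq> D"
    using D w0 by (meson open_contains_cball)
  have fp: "Ck_on (Suc (Suc k)) (partial_deriv i f) D" for i using f by simp
  have der: "(f has_derivative lin (gradient f w)) (at w)" if "w \<in> cball w0 r" for w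
    using Ck_on_has_derivative[OF f D] that r by auto
  have sd: "\<exists>C\<ge>0. \<forall>h. 0 < h \<longrightarrow> 2 * h \<le> r \<longrightarrow>
      norm (f (w0 + h *\<^sub>R axis i 1 + h *\<^sub>R axis j 1) - f (w0 + h *\<^sub>R axis i 1)
      - f (w0 + h *\<^sub>R axis j 1) + f w0 - of_real (h\<^sup>2) * partial_deriv j (partial_deriv i f) w0) \<le> 8 * C * h ^ 3" for i j
  proof -
    obtain C where C: "C \<ge> 0" "\<And>w. w \<in> cball w0 r \<Longrightarrow>
       norm (partial_deriv i f w - partial_deriv i f w0 - lin (gradient (partial_deriv i f) w0) (w - w0)) \<le> C * norm (w - w0) ^ 2"
      using C2_bound[OF fp D r(2)] by blast
    then show ?thesis
      using second_difference_bound[of w0 r f "gradient f" i "gradient (partial_deriv i f) w0" C _ j, OF der]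
      by (auto simp: gradient_def)
  qed
  let ?a = "partial_deriv i (partial_deriv j f) w0" and ?b = "partial_deriv j (partial_deriv i f) w0"
  let ?\<Delta> = "\<lambda>h. f (w0 + h *\<^sub>R axis i 1 + h *\<^sub>R axis j 1) - f (w0 + h *\<^sub>R axis i 1)
      - f (w0 + h *\<^sub>R axis j 1) + f w0"
  obtain C1 where C1: "C1 \<ge> 0" "\<And>h. 0 < h \<Longrightarrow> 2 * h \<le> r \<Longrightarrow> norm (?\<Delta> h - of_real (h\<^sup>2) * ?b) \<le> 8 * C1 * h ^ 3"
    using sd[of i j] by blast
  obtain C2 where C2: "C2 \<ge> 0" "\<And>h. 0 < h \<Longrightarrow> 2 * h \<le> r \<Longrightarrow> norm (?\<Delta> h - of_real (h\<^sup>2) * ?a) \<le> 8 * C2 * h ^ 3"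
    using sd[of j i] by (auto simp: algebra_simps)
  have le: "norm (?a - ?b) \<le> 8 * (C1 + C2) * h" if h: "0 < h" "2 * h \<le> r" for h
  proof -
    have "h\<^sup>2 * norm (?a - ?b) = norm (of_real (h\<^sup>2) * (?a - ?b))"
      by (simp add: norm_mult norm_power)
    also have "of_real (h\<^sup>2) * (?a - ?b) = (?\<Delta> h - of_real (h\<^sup>2) * ?b) - (?\<Delta> h - of_real (h\<^sup>2) * ?a)"
      by (simp add: algebra_simps)
    also have "norm \<dots> \<le> 8 * C1 * h ^ 3 + 8 * C2 * h ^ 3"
      by (rule order_trans[OF norm_triangle_ineq4]) (intro add_mono C1 C2 h)
    also have "\<dots> = h\<^sup>2 * (8 * (C1 + C2) * h)" by (simp add: power2_eq_square power3_eq_cube algebra_simps)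
    finally show ?thesis using h by simp
  qed
  have "((\<lambda>h. 8 * (C1 + C2) * h) \<longlongrightarrow> 8 * (C1 + C2) * 0) (at_right 0)"
    by (intro tendsto_intros)
  moreover have "\<forall>\<^sub>F h in at_right 0. norm (?a - ?b) \<le> 8 * (C1 + C2) * h"
    using eventually_at_right_real[of 0 "r / 2"] r(1) le by (auto elim: eventually_mono)
  ultimately have "norm (?a - ?b) \<le> 8 * (C1 + C2) * 0"
    by (rule tendsto_lowerbound) auto
  then show ?thesis by simp
qed

text \<open>The gradient of the remainder consists of the first-order Taylor remainders of the
  partial derivatives, so \<open>C2_bound\<close> followed by \<open>increment_bound\<close> gives
  order 3.\<close>

lemma C3_bound:
  fixes f :: "real^'n \<Rightarrow> complex"
  assumes f: "Ck_on (Suc (Suc (Suc k))) f D" and D: "open D" "cball w0 r \<subseteq> D" and r: "r \<ge> 0"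
  obtains C where "C \<ge> 0" "\<And>w. w \<in> cball w0 r \<Longrightarrow>
    norm (f w - f w0 - lin (gradient f w0) (w - w0) - quad (Hessian f w0) (w - w0) / 2) \<le> C * norm (w - w0) ^ 3"
proof -
  have w0: "w0 \<in> D" using D r by auto
  let ?H = "Hessian f w0"
  have sym: "?H $ i $ j = ?H $ j $ i" for i j
    unfolding Hessian_def by (simp add: mixed_partial_deriv_commute[OF f D(1) w0])
  \<comment> \<open>The gradient of the i-th partial derivative is column i of the Hessian; symmetry
    turns it into the row \<open>?H $ i\<close>.\<close>
  have grad: "gradient (partial_deriv i f) w0 = ?H $ i" for i
    using sym by (simp add: vec_eq_iff gradient_def) (simp add: Hessian_def)
  have "\<exists>B\<ge>0. \<forall>w\<in>cball w0 r. norm (partial_deriv i f w - partial_deriv i f w0 - lin (?H $ i) (w - w0)) \<le> B * norm (w - w0) ^ 2" for i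
  proof -
    have "Ck_on (Suc (Suc k)) (partial_deriv i f) D" using f by (simp only: Ck_on.simps(2)[of "Suc (Suc k)"])
    from C2_bound[OF this D] show ?thesis unfolding grad by metis
  qed
  then obtain B where B: "\<And>i. B i \<ge> 0"
      "\<And>i w. w \<in> cball w0 r \<Longrightarrow> norm (partial_deriv i f w - partial_deriv i f w0 - lin (?H $ i) (w - w0)) \<le> B i * norm (w - w0) ^ 2" by metis
  define C where "C = (\<Sum>i\<in>UNIV. B i)"
  have C: "C \<ge> 0" using B by (simp add: C_def sum_nonneg)
  let ?p = "\<lambda>w. gradient f w - gradient f w0 - (\<chi> i. lin (?H $ i) (w - w0))"
  have BC: "norm (?p w $ i) \<le> C * norm (w - w0) ^ 2" if "w \<in> cball w0 r" for w i
  proof -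
    have "norm (?p w $ i) \<le> B i * norm (w - w0) ^ 2"
      using B(2)[OF that, of i] by (simp add: gradient_def)
    also have "\<dots> \<le> C * norm (w - w0) ^ 2" unfolding C_def
      by (intro mult_right_mono member_le_sum) (auto simp: B)
    finally show ?thesis by simp
  qed
  let ?h = "\<lambda>w. f w - lin (gradient f w0) (w - w0) - quad ?H (w - w0) / 2"
  have der: "(?h has_derivative lin (?p w)) (at w)" if "w \<in> cball w0 r" for w
  proof -
    have sub: "((\<lambda>w. w - w0) has_derivative (\<lambda>v. v)) (at w)"
      by (auto intro!: derivative_eq_intros)
    have "((\<lambda>w. quad ?H (w - w0)) has_derivative lin (\<chi> i. 2 * lin (?H $ i) (w - w0))) (at w)"
      using has_derivative_compose[OF sub quad_has_derivative[OF sym]] by simp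
    then have "(?h has_derivative (\<lambda>v. lin (gradient f w) v - lin (gradient f w0) v
         - lin (\<chi> i. 2 * lin (?H $ i) (w - w0)) v / 2)) (at w)"
      using Ck_on_has_derivative[OF f D(1), of w] that D(2) sub
      by (intro has_derivative_diff bounded_linear.has_derivative[OF bounded_linear_lin]
           bounded_linear.has_derivative[OF bounded_linear_divide]) auto
    moreover have "lin (\<chi> i. 2 * lin (?H $ i) (w - w0)) v / 2 = lin (\<chi> i. lin (?H $ i) (w - w0)) v" for v
      unfolding lin_def[of "\<chi> i. _ i"] by (simp add: sum_divide_distrib)
    ultimately show ?thesis by (simp add: lin_diff_vec[abs_def])
  qed
  have "norm (?h w - ?h w0) \<le> real CARD('n) * C * norm (w - w0) ^ Suc 2" if "w \<in> cball w0 r" for w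
    by (rule increment_bound[OF der BC C that])
  moreover have "?h w - ?h w0 = f w - f w0 - lin (gradient f w0) (w - w0) - quad ?H (w - w0) / 2" for w
    by (simp add: lin_def quad_def)
  ultimately have "norm (f w - f w0 - lin (gradient f w0) (w - w0) - quad ?H (w - w0) / 2) \<le> (real CARD('n) * C) * norm (w - w0) ^ 3"
    if "w \<in> cball w0 r" for w
    using that by (simp only: numeral_3_eq_3 numeral_2_eq_2)
  then show ?thesis using C by (intro that[of "real CARD('n) * C"]) auto
qed

section \<open>Laplace's method\<close>

text \<open>Mean value inequality on the convex half-plane of real part at most \<open>M\<close>,
  where the derivative of exp has norm at most exp M.\<close>

lemma norm_exp_diff_le:
  fixes a b :: complex
  assumes "Re a \<le> M" "Re b \<le> M"
  shows "norm (exp a - exp b) \<le> exp M * norm (a - b)"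
proof (rule field_differentiable_bound[where f' = exp])
  show "convex {z. Re z \<le> M}" by (rule convex_halfspace_Re_le)
qed (use assms in \<open>auto intro!: DERIV_subset[OF DERIV_exp]\<close>)

lemma lborel_integral_affine:
  fixes f :: "'a::euclidean_space \<Rightarrow> 'b::{banach, second_countable_topology}"
  assumes f: "f \<in> borel_measurable borel" and c: "c > 0"
  shows "integral\<^sup>L lborel f = c ^ DIM('a) *\<^sub>R integral\<^sup>L lborel (\<lambda>u. f (t + c *\<^sub>R u))"
proof -
  have T: "(\<lambda>x::'a. t + c *\<^sub>R x) \<in> measurable lborel borel" by measurable
  have "integral\<^sup>L lborel f
      = integral\<^sup>L (density (distr lborel borel (\<lambda>x::'a. t + c *\<^sub>R x)) (\<lambda>_. ennreal (c ^ DIM('a)))) f"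
    using lborel_affine[of c t] c by (simp add: abs_of_pos)
  also have "\<dots> = integral\<^sup>L (distr lborel borel (\<lambda>x::'a. t + c *\<^sub>R x)) (\<lambda>x. c ^ DIM('a) *\<^sub>R f x)"
    using f c by (subst integral_density) auto
  also have "\<dots> = integral\<^sup>L lborel (\<lambda>u. c ^ DIM('a) *\<^sub>R f (t + c *\<^sub>R u))"
    using f by (subst integral_distr[OF T]) auto
  finally show ?thesis by simp
qed

section \<open>The contribution of a ball around the minimum\<close>

text \<open>\<open>Cr\<close> is the crux. In the ball |u| / x \<le> r, so the error C |u|^2 / x
  from x g2 is at most C r |u| and joins the linear term, while the error C |u|^3 / x from x^2 g3 is
  at most \<epsilon> / 4 |u|^2, half of the decay of the limiting Gaussian. Both exponents then have
  real part at most L |u| - \<epsilon> / 4 |u|^2, and they differ by at most C / x (1 +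
  |u|)^3.\<close>

lemma rescaled_integrand_bound:
  fixes g1 g2 g3 :: "real^'n \<Rightarrow> complex"
  assumes eps: "\<epsilon> > 0" and co: "\<And>u. \<epsilon> * (norm u)\<^sup>2 \<le> Re (quad H u)"
    and r: "r > 0" and C: "C \<ge> 0" and Cr: "C * r \<le> \<epsilon> / 4"
    and t1: "\<And>w. w \<in> cball w0 r \<Longrightarrow> norm (g1 w - g1 w0) \<le> C * norm (w - w0)"
    and t2: "\<And>w. w \<in> cball w0 r \<Longrightarrow> norm (g2 w - g2 w0 - lin b (w - w0)) \<le> C * norm (w - w0) ^ 2"
    and t3: "\<And>w. w \<in> cball w0 r \<Longrightarrow> norm (g3 w - g3 w0 - quad H (w - w0) / 2) \<le> C * norm (w - w0) ^ 3"
  obtains K where "K \<ge> 0" "\<And>x u. x > 0 \<Longrightarrow>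
     norm (indicator (cball w0 r) (w0 + (1 / x) *\<^sub>R u) *\<^sub>R
         (g1 (w0 + (1 / x) *\<^sub>R u) * exp (of_real x * (g2 (w0 + (1 / x) *\<^sub>R u) - g2 w0)
           - of_real (x\<^sup>2) * (g3 (w0 + (1 / x) *\<^sub>R u) - g3 w0)))
       - g1 w0 * gexp H b u) \<le> K / x * exp (- (\<epsilon> / 8) * (norm u)\<^sup>2)"
proof
  define L where "L = (\<Sum>i\<in>UNIV. norm (b $ i)) + C * r"
  \<comment> \<open>The first summand collects the errors of g1 and of the exponent inside the ball,
    the second the Gaussian left over outside it.\<close>
  define K0 where "K0 = C * (1 + norm (g1 w0)) + norm (g1 w0) / r"
  define K where "K = K0 * exp ((real 3 + L)\<^sup>2 / (2 * (\<epsilon> / 4)))"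
  have K0: "K0 \<ge> 0" using C r by (simp add: K0_def)
  then show "K \<ge> 0" by (simp add: K_def)
  fix x :: real and u :: "real^'n"
  assume x: "x > 0"
  define E where "E = exp (L * norm u - \<epsilon> / 4 * (norm u)\<^sup>2)"
  have E: "E > 0" by (simp add: E_def)
  define w where "w = w0 + (1 / x) *\<^sub>R u"
  have wu: "w - w0 = (1 / x) *\<^sub>R u" by (simp add: w_def)
  have nw: "norm (w - w0) = norm u / x" using x by (simp add: wu)
  define z0 where "z0 = lin b u - quad H u / 2"
  define z1 where "z1 = of_real x * (g2 w - g2 w0) - of_real (x\<^sup>2) * (g3 w - g3 w0)"
  have lin_w: "of_real x * lin b (w - w0) = lin b u" using x by (simp add: wu)
  have quad_w: "of_real (x\<^sup>2) * quad H (w - w0) = quad H u"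
    using x by (simp add: wu quad_def sum_distrib_left power2_eq_square field_simps)
  have lin_le: "norm (lin b u) \<le> (\<Sum>i\<in>UNIV. norm (b $ i)) * norm u" by (rule norm_lin_le)
  have Re_z0: "Re z0 \<le> L * norm u - \<epsilon> / 4 * (norm u)\<^sup>2"
  proof -
    have "Re z0 \<le> norm (lin b u) - Re (quad H u) / 2"
      using complex_Re_le_cmod[of "lin b u"] by (simp add: z0_def)
    also have "\<dots> \<le> L * norm u - \<epsilon> / 2 * (norm u)\<^sup>2"
    proof -
      have "0 \<le> C * r * norm u" using C r by simp
      then show ?thesis using lin_le co[of u] by (simp add: L_def distrib_right)
    qed
    also have "\<dots> \<le> L * norm u - \<epsilon> / 4 * (norm u)\<^sup>2"
      using eps by simp
    finally show ?thesis .
  qed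
  have cube: "1 \<le> (1 + norm u) ^ 3" "norm u \<le> (1 + norm u) ^ 3" "(norm u)\<^sup>2 + norm u ^ 3 \<le> (1 + norm u) ^ 3"
    by (simp_all add: power3_eq_cube power2_eq_square algebra_simps add_nonneg_nonneg)
  have main: "norm (indicator (cball w0 r) w *\<^sub>R (g1 w * exp z1) - g1 w0 * exp z0) \<le> K0 / x * ((1 + norm u) ^ 3 * E)"
  proof (cases "w \<in> cball w0 r")
    case True
    have ur: "norm u / x \<le> r" using True nw by (simp add: dist_norm norm_minus_commute)
    have d2: "norm (g2 w - g2 w0 - lin b (w - w0)) \<le> C * (norm u)\<^sup>2 / x\<^sup>2"
      using t2[OF True] by (simp add: nw power_divide)
    have d3: "norm (g3 w - g3 w0 - quad H (w - w0) / 2) \<le> C * norm u ^ 3 / x ^ 3"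
      using t3[OF True] by (simp add: nw power_divide)
    have e2: "norm (of_real x * (g2 w - g2 w0 - lin b (w - w0))) \<le> C * (norm u)\<^sup>2 / x"
      using mult_left_mono[OF d2, of x] x by (simp add: norm_mult power2_eq_square)
    have e3: "norm (of_real (x\<^sup>2) * (g3 w - g3 w0 - quad H (w - w0) / 2)) \<le> C * norm u ^ 3 / x"
      using mult_left_mono[OF d3, of "x\<^sup>2"] x by (simp add: norm_mult norm_power power2_eq_square power3_eq_cube)
    have z1: "z1 = z0 + of_real x * (g2 w - g2 w0 - lin b (w - w0))
        - of_real (x\<^sup>2) * (g3 w - g3 w0 - quad H (w - w0) / 2)"
      unfolding z0_def z1_def lin_w[symmetric] quad_w[symmetric] by (simp add: algebra_simps)
    have z10: "norm (z1 - z0) \<le> C / x * (1 + norm u) ^ 3"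
    proof -
      have "norm (z1 - z0) \<le> C * (norm u)\<^sup>2 / x + C * norm u ^ 3 / x"
        unfolding z1 by (rule order_trans[OF _ add_mono[OF e2 e3]])
          (metis (no_types, lifting) add_diff_cancel_left' add_diff_eq norm_triangle_ineq4)
      also have "\<dots> = C / x * ((norm u)\<^sup>2 + norm u ^ 3)" by (simp add: distrib_left add_divide_distrib)
      also have "\<dots> \<le> C / x * (1 + norm u) ^ 3"
        using C x by (intro mult_left_mono cube) auto
      finally show ?thesis .
    qed
    have Re_z1: "Re z1 \<le> L * norm u - \<epsilon> / 4 * (norm u)\<^sup>2"
    proof -
      have "Re z1 \<le> Re z0 + norm (of_real x * (g2 w - g2 w0 - lin b (w - w0)))
          + norm (of_real (x\<^sup>2) * (g3 w - g3 w0 - quad H (w - w0) / 2))"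
        unfolding z1 minus_complex.simps plus_complex.simps
        using complex_Re_le_cmod[of "of_real x * (g2 w - g2 w0 - lin b (w - w0))"]
          abs_Re_le_cmod[of "of_real (x\<^sup>2) * (g3 w - g3 w0 - quad H (w - w0) / 2)"] by linarith
      also have "\<dots> \<le> ((\<Sum>i\<in>UNIV. norm (b $ i)) * norm u - \<epsilon> / 2 * (norm u)\<^sup>2) + C * (norm u)\<^sup>2 / x + C * norm u ^ 3 / x"
      proof (intro add_mono e2 e3)
        show "Re z0 \<le> (\<Sum>i\<in>UNIV. norm (b $ i)) * norm u - \<epsilon> / 2 * (norm u)\<^sup>2"
          using complex_Re_le_cmod[of "lin b u"] lin_le co[of u] by (simp add: z0_def)
      qed
      also have "C * (norm u)\<^sup>2 / x = (C * norm u) * (norm u / x)" by (simp add: power2_eq_square)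
      also have "\<dots> \<le> (C * norm u) * r" using C by (intro mult_left_mono ur) auto
      also have "C * norm u ^ 3 / x = (C * (norm u)\<^sup>2) * (norm u / x)" by (simp add: power2_eq_square power3_eq_cube)
      also have "\<dots> \<le> (C * (norm u)\<^sup>2) * r" using C by (intro mult_left_mono ur) auto
      also have "\<dots> = (C * r) * (norm u)\<^sup>2" by simp
      also have "\<dots> \<le> \<epsilon> / 4 * (norm u)\<^sup>2" by (intro mult_right_mono Cr) auto
      finally show ?thesis by (simp add: L_def algebra_simps)
    qed
    have ez: "norm (exp z1 - exp z0) \<le> C / x * (1 + norm u) ^ 3 * E"
      using order_trans[OF norm_exp_diff_le[OF Re_z1 Re_z0] mult_left_mono[OF z10]]
      by (simp add: E_def mult_ac)
    have e1: "norm (exp z1) \<le> E" using Re_z1 by (simp add: E_def)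
    have "norm (g1 w * exp z1 - g1 w0 * exp z0) = norm ((g1 w - g1 w0) * exp z1 + g1 w0 * (exp z1 - exp z0))"
      by (simp add: algebra_simps)
    also have "\<dots> \<le> (C * (norm u / x)) * E + norm (g1 w0) * (C / x * (1 + norm u) ^ 3 * E)"
      by (rule order_trans[OF norm_triangle_ineq], unfold norm_mult)
         (use t1[OF True] C x E e1 ez in \<open>intro add_mono mult_mono order_refl; simp add: nw\<close>)
    also have "\<dots> \<le> (C * ((1 + norm u) ^ 3 / x)) * E + norm (g1 w0) * (C / x * (1 + norm u) ^ 3 * E)"
      using cube(2) C x E by (intro add_mono mult_right_mono mult_left_mono divide_right_mono) auto
    also have "\<dots> = C * (1 + norm (g1 w0)) / x * ((1 + norm u) ^ 3 * E)"
      by (simp add: algebra_simps add_divide_distrib)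
    also have "\<dots> \<le> K0 / x * ((1 + norm u) ^ 3 * E)"
      using C x r E unfolding K0_def by (intro mult_right_mono divide_right_mono) auto
    finally show ?thesis using True by simp
  next
    case False
    \<comment> \<open>Outside the ball the cut-off integrand is zero. The ratio |u| / (x r) is at
      least 1 there, and multiplying the Gaussian by it produces the required 1 / x.\<close>
    then have "1 * r \<le> norm u / x" using nw by (simp add: dist_norm norm_minus_commute)
    then have ur: "1 \<le> norm u / x / r" by (simp only: pos_le_divide_eq[OF r])
    have "norm (g1 w0 * exp z0) \<le> norm (g1 w0) * E"
      unfolding norm_mult using Re_z0 by (intro mult_left_mono) (auto simp: E_def)
    also have "\<dots> \<le> (norm (g1 w0) * E) * (norm u / x / r)"
      using mult_left_mono[OF ur, of "norm (g1 w0) * E"] E by simp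
    also have "\<dots> \<le> (norm (g1 w0) * E) * ((1 + norm u) ^ 3 / x / r)"
      using cube(2) x r E by (intro mult_left_mono divide_right_mono) auto
    also have "\<dots> = norm (g1 w0) / r / x * ((1 + norm u) ^ 3 * E)" by (simp add: mult_ac)
    also have "\<dots> \<le> K0 / x * ((1 + norm u) ^ 3 * E)"
      using C x r E unfolding K0_def by (intro mult_right_mono divide_right_mono) auto
    finally show ?thesis using False by simp
  qed
  also have "\<dots> \<le> K0 / x * (exp ((real 3 + L)\<^sup>2 / (2 * (\<epsilon> / 4))) * exp (- (\<epsilon> / 4 / 2) * (norm u)\<^sup>2))"
    unfolding E_def using K0 x eps by (intro mult_left_mono poly_exp_le_gaussian) auto
  also have "\<dots> = K / x * exp (- (\<epsilon> / 8) * (norm u)\<^sup>2)"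
    by (simp add: K_def)
  finally show "norm (indicator (cball w0 r) (w0 + (1 / x) *\<^sub>R u) *\<^sub>R
         (g1 (w0 + (1 / x) *\<^sub>R u) * exp (of_real x * (g2 (w0 + (1 / x) *\<^sub>R u) - g2 w0)
           - of_real (x\<^sup>2) * (g3 (w0 + (1 / x) *\<^sub>R u) - g3 w0)))
       - g1 w0 * gexp H b u) \<le> K / x * exp (- (\<epsilon> / 8) * (norm u)\<^sup>2)"
    by (simp only: w_def z1_def z0_def gexp_def)
qed

text \<open>The pointwise bound is integrated after the substitution, whose Jacobian x^(-n) cancels
  the factor x^n.\<close>

lemma local_integral_estimate:
  fixes g1 g2 g3 :: "real^'n \<Rightarrow> complex"
  assumes eps: "\<epsilon> > 0" and co: "\<And>u. \<epsilon> * (norm u)\<^sup>2 \<le> Re (quad H u)" and sym: "\<And>i j. H $ i $ j = H $ j $ i"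
    and cont: "continuous_on (cball w0 r) g1" "continuous_on (cball w0 r) g2" "continuous_on (cball w0 r) g3"
    and r: "r > 0" and C: "C \<ge> 0" and Cr: "C * r \<le> \<epsilon> / 4"
    and t1: "\<And>w. w \<in> cball w0 r \<Longrightarrow> norm (g1 w - g1 w0) \<le> C * norm (w - w0)"
    and t2: "\<And>w. w \<in> cball w0 r \<Longrightarrow> norm (g2 w - g2 w0 - lin b (w - w0)) \<le> C * norm (w - w0) ^ 2"
    and t3: "\<And>w. w \<in> cball w0 r \<Longrightarrow> norm (g3 w - g3 w0 - quad H (w - w0) / 2) \<le> C * norm (w - w0) ^ 3"
  defines "P \<equiv> \<lambda>x w. g1 w * exp (of_real x * (g2 w - g2 w0) - of_real (x\<^sup>2) * (g3 w - g3 w0))"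
  obtains K where "K \<ge> 0" "\<And>x. x > 0 \<Longrightarrow>
     norm (of_real (x ^ CARD('n)) * (LBINT w:cball w0 r. P x w) - g1 w0 * integral\<^sup>L lborel (gexp H b)) \<le> K / x"
proof -
  obtain K where K: "K \<ge> 0" "\<And>x u. x > 0 \<Longrightarrow>
     norm (indicator (cball w0 r) (w0 + (1 / x) *\<^sub>R u) *\<^sub>R P x (w0 + (1 / x) *\<^sub>R u)
       - g1 w0 * gexp H b u) \<le> K / x * exp (- (\<epsilon> / 8) * (norm u)\<^sup>2)"
    using rescaled_integrand_bound[OF eps co r C Cr t1 t2 t3] unfolding P_def by metis
  let ?J = "integral\<^sup>L lborel (\<lambda>u::real^'n. exp (- (\<epsilon> / 8) * (norm u)\<^sup>2))"
  have intg: "integrable lborel (\<lambda>u::real^'n. D * exp (- (\<epsilon> / 8) * (norm u)\<^sup>2))" for D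
    using eps by (intro integrable_gaussian) auto
  have "norm (of_real (x ^ CARD('n)) * (LBINT w:cball w0 r. P x w) - g1 w0 * integral\<^sup>L lborel (gexp H b)) \<le> (K * ?J) / x"
    if x: "x > 0" for x
  proof -
    let ?N = "\<lambda>w. indicator (cball w0 r) w *\<^sub>R P x w"
    let ?N' = "\<lambda>u. ?N (w0 + (1 / x) *\<^sub>R u)"
    have N [measurable]: "?N \<in> borel_measurable borel"
      unfolding P_def by (intro borel_measurable_continuous_on_indicator continuous_intros cont) auto
    have gi: "integrable lborel (\<lambda>u. g1 w0 * gexp H b u)"
      using gexp_moments(1)[OF sym eps co] by simp
    have di: "integrable lborel (\<lambda>u. ?N' u - g1 w0 * gexp H b u)"
      by (rule Bochner_Integration.integrable_bound[OF intg[of "K / x"]])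
         (use K x in \<open>auto intro!: AE_I2\<close>)
    have Ni: "integrable lborel ?N'"
      using Bochner_Integration.integrable_add[OF di gi] by simp
    have "(LBINT w:cball w0 r. P x w) = (1 / x) ^ CARD('n) *\<^sub>R integral\<^sup>L lborel ?N'"
      unfolding set_lebesgue_integral_def using lborel_integral_affine[OF N, of "1 / x" w0] x by simp
    then have "of_real (x ^ CARD('n)) * (LBINT w:cball w0 r. P x w) = integral\<^sup>L lborel ?N'"
      using x by (simp add: scaleR_conv_of_real power_divide)
    then have "of_real (x ^ CARD('n)) * (LBINT w:cball w0 r. P x w) - g1 w0 * integral\<^sup>L lborel (gexp H b)
       = integral\<^sup>L lborel (\<lambda>u. ?N' u - g1 w0 * gexp H b u)"
      using Bochner_Integration.integral_diff[OF Ni gi] gexp_moments(1)[OF sym eps co, of b] by simp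
    also have "norm \<dots> \<le> integral\<^sup>L lborel (\<lambda>u. norm (?N' u - g1 w0 * gexp H b u))"
      by (rule integral_norm_bound)
    also have "\<dots> \<le> integral\<^sup>L lborel (\<lambda>u::real^'n. K / x * exp (- (\<epsilon> / 8) * (norm u)\<^sup>2))"
      by (intro integral_mono integrable_norm di intg K x)
    also have "\<dots> = (K * ?J) / x" by simp
    finally show ?thesis .
  qed
  moreover have "K * ?J \<ge> 0" using K by (intro mult_nonneg_nonneg integral_nonneg_AE) auto
  ultimately show ?thesis using that by blast
qed

section \<open>The contribution away from the minimum\<close>

text \<open>A strict minimum alone gives no gap, since \<open>f\<close> could approach it at the
  boundary of \<open>D\<close> or at infinity. Outside \<open>K\<close> the gap \<delta> is given;
  on the part of \<open>K\<close> outside the ball, compactness turns strictness into a gap.\<close>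

lemma gap_away_from_minimum:
  fixes f :: "'a::metric_space \<Rightarrow> real"
  assumes cont: "continuous_on D f" and r: "r > 0"
    and min: "\<And>w. w \<in> D \<Longrightarrow> w \<noteq> w0 \<Longrightarrow> f w0 < f w"
    and K: "compact K" "K \<subseteq> D" "\<delta> > 0" "\<And>w. w \<in> D - K \<Longrightarrow> f w0 + \<delta> \<le> f w"
  obtains \<eta> where "\<eta> > 0" "\<And>w. w \<in> D - ball w0 r \<Longrightarrow> f w0 + \<eta> \<le> f w"
proof (cases "K - ball w0 r = {}")
  case True
  then have "f w0 + \<delta> \<le> f w" if "w \<in> D - ball w0 r" for w
    using K(4)[of w] that by blast
  with K(3) show ?thesis using that by blast
next
  case False
  have "compact (K - ball w0 r)" using K by (intro compact_diff) auto
  moreover have "continuous_on (K - ball w0 r) f" using K by (intro continuous_on_subset[OF cont]) auto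
  ultimately obtain z where z: "z \<in> K - ball w0 r" "\<And>w. w \<in> K - ball w0 r \<Longrightarrow> f z \<le> f w"
    using continuous_attains_inf[OF _ False] by metis
  then have "z \<in> D" "z \<noteq> w0" using K r by auto
  then have "f w0 < f z" by (rule min)
  then show ?thesis
    using K z by (intro that[of "min \<delta> (f z - f w0)"]) (auto simp: min_def not_le, force+)
qed

text \<open>Put q = x^2 - c2 x - c1. Of x^2 Re g3, the part c2 x Re g3 pays for x Re g2, the part c1
  Re g3 stays as integrable weight, and the gap bounds q Re g3 from below. This leaves a factor exp
  (- \<eta> x^2 + O(x)), which beats every power of x.\<close>

lemma tail_estimate:
  fixes g1 g2 g3 :: "'a::euclidean_space \<Rightarrow> complex"
  assumes meas: "T \<in> sets borel" and c: "c1 > 0" "c2 > 0" and \<eta>: "\<eta> > 0"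
    and int: "set_integrable lborel T (\<lambda>w. g1 w * exp (- of_real c1 * g3 w))"
    and le: "\<And>w. w \<in> T \<Longrightarrow> Re (g2 w) \<le> c2 * Re (g3 w)"
    and gap: "\<And>w. w \<in> T \<Longrightarrow> m3 + \<eta> \<le> Re (g3 w)"
    and a: "Re a3 = m3"
    and Pm: "\<And>x. (\<lambda>w. indicator T w *\<^sub>R (g1 w * exp (of_real x * (g2 w - a2) - of_real (x\<^sup>2) * (g3 w - a3))))
         \<in> borel_measurable borel"
  defines "P \<equiv> \<lambda>x w. g1 w * exp (of_real x * (g2 w - a2) - of_real (x\<^sup>2) * (g3 w - a3))"
  obtains K where "K \<ge> 0" "\<And>x. x \<ge> 1 + c1 + c2 \<Longrightarrow> set_integrable lborel T (P x)"
    "\<And>x. x \<ge> 1 + c1 + c2 \<Longrightarrow> x ^ n * norm (LBINT w:T. P x w) \<le> K / x"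
proof -
  define A where "A = integral\<^sup>L lborel (\<lambda>w. norm (indicator T w *\<^sub>R (g1 w * exp (- of_real c1 * g3 w))))"
  \<comment> \<open>\<beta> and \<gamma> are the coefficients of x and of 1 once Re g3 is replaced
    by m3 + \<eta> in q Re g3; the terms x^2 m3 cancel and leave - \<eta> x^2.\<close>
  define \<beta> where "\<beta> = c2 * (m3 + \<eta>) - Re a2"
  define \<gamma> where "\<gamma> = c1 * (m3 + \<eta>)"
  have A: "A \<ge> 0" unfolding A_def by (intro integral_nonneg_AE) auto
  let ?G = "\<lambda>w. indicator T w *\<^sub>R (g1 w * exp (- of_real c1 * g3 w))"
  have intG: "integrable lborel (\<lambda>w. D * norm (?G w))" for D :: real
    using int unfolding set_integrable_def by (intro integrable_mult_right integrable_norm)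
  have bound: "norm (indicator T w *\<^sub>R P x w) \<le> exp (\<beta> * x - \<eta> * x\<^sup>2 + \<gamma>) * norm (?G w)"
    if x: "x \<ge> 1 + c1 + c2" for x w
  proof (cases "w \<in> T")
    case True
    \<comment> \<open>The gap may be multiplied by q only when q \<ge> 0; the threshold on x ensures
      it, as x^2 \<ge> x + c1 x + c2 x \<ge> c1 + c2 x.\<close>
    define q where "q = x\<^sup>2 - c2 * x - c1"
    have x1: "x \<ge> 1" using x c by linarith
    have "c1 * 1 \<le> c1 * x" using c x1 by (intro mult_left_mono) auto
    moreover have "(1 + c1 + c2) * x \<le> x * x" using x x1 by (intro mult_right_mono) auto
    ultimately have q: "q \<ge> 0" using x1 by (simp add: q_def power2_eq_square algebra_simps)
    have "Re (of_real x * (g2 w - a2) - of_real (x\<^sup>2) * (g3 w - a3))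
        = x * Re (g2 w) - x * Re a2 - x\<^sup>2 * Re (g3 w) + x\<^sup>2 * m3"
      using a by (simp add: algebra_simps)
    also have "\<dots> \<le> x * (c2 * Re (g3 w)) - x * Re a2 - x\<^sup>2 * Re (g3 w) + x\<^sup>2 * m3"
      using mult_left_mono[OF le[OF True], of x] x1 by simp
    also have "\<dots> = - c1 * Re (g3 w) - q * Re (g3 w) - x * Re a2 + x\<^sup>2 * m3"
      by (simp add: q_def algebra_simps)
    also have "\<dots> \<le> - c1 * Re (g3 w) - q * (m3 + \<eta>) - x * Re a2 + x\<^sup>2 * m3"
      using mult_left_mono[OF gap[OF True] q] by simp
    also have "\<dots> = (\<beta> * x - \<eta> * x\<^sup>2 + \<gamma>) + - c1 * Re (g3 w)"
      by (simp add: q_def \<beta>_def \<gamma>_def algebra_simps)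
    finally have "norm (exp (of_real x * (g2 w - a2) - of_real (x\<^sup>2) * (g3 w - a3)))
       \<le> exp (\<beta> * x - \<eta> * x\<^sup>2 + \<gamma>) * norm (exp (- of_real c1 * g3 w))"
      by (simp add: exp_add[symmetric])
    from mult_left_mono[OF this, of "norm (g1 w)"] show ?thesis
      using True by (simp add: P_def norm_mult mult_ac)
  qed simp
  have si: "integrable lborel (\<lambda>w. indicator T w *\<^sub>R P x w)" if x: "x \<ge> 1 + c1 + c2" for x
  proof (rule Bochner_Integration.integrable_bound[OF intG])
    show "(\<lambda>w. indicator T w *\<^sub>R P x w) \<in> borel_measurable lborel"
      unfolding P_def using Pm by simp
    show "AE w in lborel. norm (indicator T w *\<^sub>R P x w) \<le> norm (exp (\<beta> * x - \<eta> * x\<^sup>2 + \<gamma>) * norm (?G w))"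
      using bound[OF x] by (intro AE_I2) auto
  qed
  \<comment> \<open>\<open>Suc n\<close> because one more power of x is needed to pay for the
    claimed 1 / x.\<close>
  define K where "K = A * exp \<gamma> * exp ((real (Suc n) + \<beta>)\<^sup>2 / (2 * \<eta>))"
  have "K \<ge> 0" using A by (simp add: K_def)
  moreover have "set_integrable lborel T (P x)" if "x \<ge> 1 + c1 + c2" for x
    using si[OF that] by (simp add: set_integrable_def)
  moreover have "x ^ n * norm (LBINT w:T. P x w) \<le> K / x" if x: "x \<ge> 1 + c1 + c2" for x
  proof -
    have x1: "x \<ge> 1" using x c by linarith
    have "norm (LBINT w:T. P x w) \<le> integral\<^sup>L lborel (\<lambda>w. norm (indicator T w *\<^sub>R P x w))"
      unfolding set_lebesgue_integral_def by (rule integral_norm_bound)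
    also have "\<dots> \<le> integral\<^sup>L lborel (\<lambda>w. exp (\<beta> * x - \<eta> * x\<^sup>2 + \<gamma>) * norm (?G w))"
      by (intro integral_mono integrable_norm si x intG bound)
    also have "\<dots> = exp (\<beta> * x - \<eta> * x\<^sup>2 + \<gamma>) * A"
      unfolding A_def by (rule integral_mult_right_zero)
    finally have n1: "norm (LBINT w:T. P x w) \<le> exp (\<beta> * x - \<eta> * x\<^sup>2) * exp \<gamma> * A"
      by (simp add: exp_add)
    have "x ^ Suc n * exp (\<beta> * x - \<eta> * x\<^sup>2) \<le> (1 + x) ^ Suc n * exp (\<beta> * x - \<eta> * x\<^sup>2)"
      using x1 by (intro mult_right_mono power_mono) auto
    also have "\<dots> \<le> exp ((real (Suc n) + \<beta>)\<^sup>2 / (2 * \<eta>)) * exp (- (\<eta> / 2) * x\<^sup>2)"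
      using x1 \<eta> by (intro poly_exp_le_gaussian) auto
    also have "\<dots> \<le> exp ((real (Suc n) + \<beta>)\<^sup>2 / (2 * \<eta>)) * 1"
      using \<eta> by (intro mult_left_mono) auto
    finally have n2: "x ^ Suc n * exp (\<beta> * x - \<eta> * x\<^sup>2) \<le> exp ((real (Suc n) + \<beta>)\<^sup>2 / (2 * \<eta>))"
      by simp
    have "x * (x ^ n * norm (LBINT w:T. P x w)) \<le> x * (x ^ n * (exp (\<beta> * x - \<eta> * x\<^sup>2) * exp \<gamma> * A))"
      using x1 n1 by (intro mult_left_mono) auto
    also have "\<dots> = (x ^ Suc n * exp (\<beta> * x - \<eta> * x\<^sup>2)) * (exp \<gamma> * A)" by simp
    also have "\<dots> \<le> exp ((real (Suc n) + \<beta>)\<^sup>2 / (2 * \<eta>)) * (exp \<gamma> * A)"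
      using A by (intro mult_right_mono n2) auto
    also have "\<dots> = K" by (simp add: K_def)
    finally show ?thesis using x1 by (simp add: pos_le_divide_eq mult.commute)
  qed
  ultimately show ?thesis using that by blast
qed

text \<open>The factor 1 + O(1 / x) is expressed by an error function \<open>E\<close> in an exact
  identity. \<open>min_not_approached_at_boundary_or_infinity\<close> keeps Re g3 away from its
  minimal value near the edge of \<open>D\<close> and far out, where the integrand could otherwise
  compete with the main term.\<close>

theorem lemma5:
  fixes g1 g2 g3 :: "real^'n \<Rightarrow> complex"
    and D :: "(real^'n) set"
    and w0 :: "real^'n"
  assumes "open D" and "connected D"
    and "Ck_on 1 g1 D" and "Ck_on 2 g2 D" and "Ck_on 3 g3 D"
    and "w0 \<in> interior D"
    and "\<And>w. w \<in> D \<Longrightarrow> w \<noteq> w0 \<Longrightarrow> Re (g3 w0) < Re (g3 w)"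
    and min_not_approached_at_boundary_or_infinity:
      "\<exists>K \<delta>. compact K \<and> K \<subseteq> D \<and> \<delta> > 0 \<and> (\<forall>w\<in>D - K. Re (g3 w0) + \<delta> \<le> Re (g3 w))"
    and "gradient g3 w0 = 0"
    and "pos_definite (Re_matrix (Hessian g3 w0))"
    and "g1 w0 \<noteq> 0"
    and "\<exists>c1::real. c1 > 0 \<and>
      (\<lambda>w. g1 w * exp (- complex_of_real c1 * g3 w)) absolutely_integrable_on D"
    and "\<exists>c2::real. c2 > 0 \<and> (\<forall>w\<in>D. Re (g2 w) \<le> c2 * Re (g3 w))"
  shows "\<exists>E::real \<Rightarrow> complex. E \<in> O[at_top](\<lambda>x. complex_of_real (1 / x)) \<and>
    (\<forall>\<^sub>F x in at_top.
      (LINT w:D|lebesgue.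
         g1 w * exp (complex_of_real x * g2 w - complex_of_real (x\<^sup>2) * g3 w)) =
      complex_of_real ((2 * pi) powr (real CARD('n) / 2)) * g1 w0
        / (complex_of_real (x ^ CARD('n)) * sqrt_det (Hessian g3 w0))
        * exp (complex_of_real x * g2 w0 - complex_of_real (x\<^sup>2) * g3 w0
               + 1 / 2 * bilin_dot (gradient g2 w0)
                           (matrix_inv (Hessian g3 w0) *v gradient g2 w0))
        * (1 + E x))"
proof -
  let ?n = "CARD('n)"
  let ?H = "Hessian g3 w0" and ?b = "gradient g2 w0"
  define m3 where "m3 = Re (g3 w0)"
  have D: "open D" by fact
  have w0: "w0 \<in> D" using \<open>w0 \<in> interior D\<close> interior_subset by blast
  have C1: "Ck_on (Suc 0) g1 D" and C2: "Ck_on (Suc (Suc 0)) g2 D" and C3: "Ck_on (Suc (Suc (Suc 0))) g3 D"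
    using \<open>Ck_on 1 g1 D\<close> \<open>Ck_on 2 g2 D\<close> \<open>Ck_on 3 g3 D\<close>
    by (simp_all only: One_nat_def numeral_2_eq_2 numeral_3_eq_3)
  have cont: "continuous_on D g1" "continuous_on D g2" "continuous_on D g3"
    by (rule Ck_on_continuous_on[OF C1], rule Ck_on_continuous_on[OF C2], rule Ck_on_continuous_on[OF C3])
  have sym: "?H $ i $ j = ?H $ j $ i" for i j
    unfolding Hessian_def by (simp add: mixed_partial_deriv_commute[OF C3 D w0])
  then have tr: "transpose ?H = ?H" by (simp add: transpose_def vec_eq_iff)
  have pd: "pos_definite (Re_matrix ?H)" by fact
  obtain \<epsilon> where eps: "\<epsilon> > 0" and co: "\<And>u. \<epsilon> * (norm u)\<^sup>2 \<le> Re (quad ?H u)"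
    using pos_definite_coercive[OF pd] by blast
  obtain R where R: "R > 0" "cball w0 R \<subseteq> D" using D w0 by (meson open_contains_cball)
  obtain B1 where B1: "B1 \<ge> 0" "\<And>w. w \<in> cball w0 R \<Longrightarrow> norm (g1 w - g1 w0) \<le> B1 * norm (w - w0)"
    using C1_bound[OF C1 D R(2)] by blast
  obtain B2 where B2: "B2 \<ge> 0" "\<And>w. w \<in> cball w0 R \<Longrightarrow> norm (g2 w - g2 w0 - lin ?b (w - w0)) \<le> B2 * norm (w - w0) ^ 2"
    using C2_bound[OF C2 D R(2)] by blast
  obtain B3 where B3: "B3 \<ge> 0" "\<And>w. w \<in> cball w0 R \<Longrightarrow>
      norm (g3 w - g3 w0 - lin (gradient g3 w0) (w - w0) - quad ?H (w - w0) / 2) \<le> B3 * norm (w - w0) ^ 3"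
    using C3_bound[OF C3 D R(2)] R(1) by (metis less_imp_le)
  define C where "C = B1 + B2 + B3"
  have C: "C \<ge> 0" "B1 \<le> C" "B2 \<le> C" "B3 \<le> C" using B1 B2 B3 by (auto simp: C_def)
  \<comment> \<open>Chosen to give C r \<le> \<epsilon> / 4; the + 1 keeps r positive when C =
    0.\<close>
  define r where "r = min R (\<epsilon> / (4 * (C + 1)))"
  have r: "r > 0" "r \<le> R" "r \<le> \<epsilon> / (4 * (C + 1))" using R eps C by (auto simp: r_def)
  have Cr: "C * r \<le> \<epsilon> / 4"
  proof -
    have "C * r \<le> (C + 1) * (\<epsilon> / (4 * (C + 1)))"
      using r C by (intro mult_mono) auto
    also have "\<dots> = \<epsilon> / 4" using C by (simp add: field_simps)
    finally show ?thesis .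
  qed
  have sub: "cball w0 r \<subseteq> cball w0 R" "cball w0 r \<subseteq> D" using r R by auto
  have t1: "norm (g1 w - g1 w0) \<le> C * norm (w - w0)" if "w \<in> cball w0 r" for w
    using B1(2)[of w] that sub mult_right_mono[OF C(2), of "norm (w - w0)"] by fastforce
  have t2: "norm (g2 w - g2 w0 - lin ?b (w - w0)) \<le> C * norm (w - w0) ^ 2" if "w \<in> cball w0 r" for w
    using B2(2)[of w] that sub mult_right_mono[OF C(3), of "norm (w - w0) ^ 2"] by fastforce
  have t3: "norm (g3 w - g3 w0 - quad ?H (w - w0) / 2) \<le> C * norm (w - w0) ^ 3" if "w \<in> cball w0 r" for w
  proof -
    have "lin (gradient g3 w0) (w - w0) = 0" using \<open>gradient g3 w0 = 0\<close> by (simp add: lin_def)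
    then show ?thesis
      using B3(2)[of w] that sub mult_right_mono[OF C(4), of "norm (w - w0) ^ 3"] by fastforce
  qed
  \<comment> \<open>The integrand divided by its exponential factor at \<open>w0\<close>; x^n times
    its integral tends to g1(w0) \<open>J\<close>.\<close>
  define P where "P = (\<lambda>x w. g1 w * exp (of_real x * (g2 w - g2 w0) - of_real (x\<^sup>2) * (g3 w - g3 w0)))"
  define J where "J = integral\<^sup>L lborel (gexp ?H ?b)"
  note contr = continuous_on_subset[OF cont(1) sub(2)] continuous_on_subset[OF cont(2) sub(2)]
    continuous_on_subset[OF cont(3) sub(2)]
  obtain K1 where K1: "K1 \<ge> 0" "\<And>x. x > 0 \<Longrightarrow>
     norm (of_real (x ^ ?n) * (LBINT w:cball w0 r. P x w) - g1 w0 * J) \<le> K1 / x"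
    using local_integral_estimate[OF eps co sym contr r(1) C(1) Cr t1 t2 t3] unfolding P_def J_def by blast
  obtain Kc \<delta> where Kc: "compact Kc" "Kc \<subseteq> D" "\<delta> > 0" "\<And>w. w \<in> D - Kc \<Longrightarrow> Re (g3 w0) + \<delta> \<le> Re (g3 w)"
    using min_not_approached_at_boundary_or_infinity by blast
  obtain \<eta> where \<eta>: "\<eta> > 0" "\<And>w. w \<in> D - ball w0 r \<Longrightarrow> Re (g3 w0) + \<eta> \<le> Re (g3 w)"
    using gap_away_from_minimum[OF continuous_on_Re[OF cont(3)] r(1) assms(7) Kc] by blast
  obtain c1 where c1: "c1 > 0" "(\<lambda>w. g1 w * exp (- of_real c1 * g3 w)) absolutely_integrable_on D"
    using assms(12) by blast
  obtain c2 where c2: "c2 > 0" "\<And>w. w \<in> D \<Longrightarrow> Re (g2 w) \<le> c2 * Re (g3 w)"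
    using assms(13) by blast
  let ?T = "D - cball w0 r"
  have T: "open ?T" using D by (intro open_Diff) auto
  have contT: "continuous_on ?T g1" "continuous_on ?T g2" "continuous_on ?T g3"
    using cont by (auto intro: continuous_on_subset)
  \<comment> \<open>The hypothesis concerns the completed measure. The integrand is continuous on
    the open set \<open>D\<close>, hence Borel after cutting off, so integrability passes to
    \<open>lborel\<close>.\<close>
  have intD: "set_integrable lborel D (\<lambda>w. g1 w * exp (- of_real c1 * g3 w))"
  proof -
    have "(\<lambda>w. indicator D w *\<^sub>R (g1 w * exp (- of_real c1 * g3 w))) \<in> borel_measurable lborel"
      using D by (simp, intro borel_measurable_continuous_on_indicator continuous_intros cont) auto
    from integrable_completion[OF this] c1(2) show ?thesis
      unfolding set_integrable_def by blast
  qed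
  have intT: "set_integrable lborel ?T (\<lambda>w. g1 w * exp (- of_real c1 * g3 w))"
    by (rule set_integrable_subset[OF intD]) (use T in auto)
  have measT: "(\<lambda>w. indicator ?T w *\<^sub>R (g1 w * exp (of_real x * (g2 w - g2 w0) - of_real (x\<^sup>2) * (g3 w - g3 w0))))
         \<in> borel_measurable borel" for x :: real
    using T by (intro borel_measurable_continuous_on_indicator continuous_intros contT) auto
  have "?T \<in> sets borel" using T by simp
  moreover have "Re (g2 w) \<le> c2 * Re (g3 w)" if "w \<in> ?T" for w using c2(2) that by auto
  moreover have "m3 + \<eta> \<le> Re (g3 w)" if "w \<in> ?T" for w using \<eta>(2)[of w] that by (auto simp: m3_def)
  ultimately obtain K2 where K2: "K2 \<ge> 0" "\<And>x. x \<ge> 1 + c1 + c2 \<Longrightarrow> set_integrable lborel ?T (P x)"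
    "\<And>x. x \<ge> 1 + c1 + c2 \<Longrightarrow> x ^ ?n * norm (LBINT w:?T. P x w) \<le> K2 / x"
    using tail_estimate[OF _ c1(1) c2(1) \<eta>(1) intT _ _ m3_def[symmetric] measT, of ?n] unfolding P_def by blast
  define I where "I = (\<lambda>x. LBINT w:D. P x w)"
  have est: "norm (of_real (x ^ ?n) * I x - g1 w0 * J) \<le> (K1 + K2) / x" if x: "x \<ge> 1 + c1 + c2" for x
  proof -
    have x1: "x \<ge> 1" using x c1 c2 by linarith
    have "set_integrable lborel (cball w0 r) (P x)"
      unfolding P_def by (intro borel_integrable_compact[folded set_integrable_def] continuous_intros contr) auto
    moreover have "cball w0 r \<union> ?T = D" "cball w0 r \<inter> ?T = {}" using sub by auto
    ultimately have "I x = (LBINT w:cball w0 r. P x w) + (LBINT w:?T. P x w)"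
      unfolding I_def using set_integral_Un[OF _ _ K2(2)[OF x], of "cball w0 r"] by simp
    then have "of_real (x ^ ?n) * I x - g1 w0 * J
       = (of_real (x ^ ?n) * (LBINT w:cball w0 r. P x w) - g1 w0 * J) + of_real (x ^ ?n) * (LBINT w:?T. P x w)"
      by (simp add: algebra_simps)
    also have "norm \<dots> \<le> K1 / x + K2 / x"
      using K1(2)[of x] K2(3)[OF x] x1
      by (intro order_trans[OF norm_triangle_ineq] add_mono) (auto simp: norm_mult norm_power)
    finally show ?thesis by (simp add: add_divide_distrib)
  qed
  have sd: "sqrt_det ?H \<noteq> 0" by (rule gexp_integral(1)[OF tr pd])
  have J: "J = of_real ((2 * pi) powr (real ?n / 2)) / sqrt_det ?H
      * exp (1 / 2 * bilin_dot ?b (matrix_inv ?H *v ?b))"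
    unfolding J_def by (rule gexp_integral(2)[OF tr pd])
  have J0: "g1 w0 * J \<noteq> 0" using sd \<open>g1 w0 \<noteq> 0\<close> by (simp add: J)
  \<comment> \<open>The exact relative error, so the identity holds for every x > 0; its bound is
    derived for x \<ge> 1 + c1 + c2.\<close>
  define E where "E = (\<lambda>x::real. of_real (x ^ ?n) * I x / (g1 w0 * J) - 1)"
  have "E \<in> O[at_top](\<lambda>x. complex_of_real (1 / x))"
  proof (rule bigoI[where c = "(K1 + K2) / norm (g1 w0 * J)"])
    show "\<forall>\<^sub>F x in at_top. norm (E x) \<le> (K1 + K2) / norm (g1 w0 * J) * norm (complex_of_real (1 / x))"
      using eventually_ge_at_top[of "1 + c1 + c2"]
    proof eventually_elim
      case (elim x)
      have x1: "x \<ge> 1" using elim c1 c2 by linarith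
      have "E x = (of_real (x ^ ?n) * I x - g1 w0 * J) / (g1 w0 * J)"
        using J0 unfolding E_def by (simp add: diff_divide_distrib)
      then have "norm (E x) = norm (of_real (x ^ ?n) * I x - g1 w0 * J) / norm (g1 w0 * J)"
        by (simp only: norm_divide)
      also have "\<dots> \<le> (K1 + K2) / x / norm (g1 w0 * J)"
        using est[OF elim] by (intro divide_right_mono) auto
      also have "\<dots> = (K1 + K2) / norm (g1 w0 * J) * norm (complex_of_real (1 / x))"
        unfolding norm_of_real using x1 by (simp add: mult.commute)
      finally show ?case .
    qed
  qed
  moreover have "\<forall>\<^sub>F x in at_top.
      (LINT w:D|lebesgue.
         g1 w * exp (complex_of_real x * g2 w - complex_of_real (x\<^sup>2) * g3 w)) =
      complex_of_real ((2 * pi) powr (real CARD('n) / 2)) * g1 w0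
        / (complex_of_real (x ^ CARD('n)) * sqrt_det (Hessian g3 w0))
        * exp (complex_of_real x * g2 w0 - complex_of_real (x\<^sup>2) * g3 w0
               + 1 / 2 * bilin_dot (gradient g2 w0)
                           (matrix_inv (Hessian g3 w0) *v gradient g2 w0))
        * (1 + E x)"
    using eventually_gt_at_top[of 0]
  proof eventually_elim
    case (elim x)
    let ?e = "exp (complex_of_real x * g2 w0 - complex_of_real (x\<^sup>2) * g3 w0)"
    let ?F = "\<lambda>w. indicator D w *\<^sub>R (g1 w * exp (complex_of_real x * g2 w - complex_of_real (x\<^sup>2) * g3 w))"
    have "?F \<in> borel_measurable lborel"
      using D by (simp, intro borel_measurable_continuous_on_indicator continuous_intros cont) auto
    then have "integral\<^sup>L lebesgue ?F = integral\<^sup>L lborel ?F" by (rule integral_completion)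
    also have "integral\<^sup>L lborel ?F = integral\<^sup>L lborel (\<lambda>w. ?e * (indicator D w *\<^sub>R P x w))"
      by (rule Bochner_Integration.integral_cong)
         (auto simp: P_def indicator_def exp_add[symmetric] algebra_simps)
    also have "\<dots> = ?e * I x"
      unfolding I_def set_lebesgue_integral_def by (rule integral_mult_right_zero)
    also have "I x = g1 w0 * J / of_real (x ^ ?n) * (1 + E x)"
      using J0 elim by (simp add: E_def)
    finally show ?case
      unfolding set_lebesgue_integral_def J exp_add by (simp add: mult_ac)
  qed
  ultimately show ?thesis by blast
qed

end
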